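(* Let $\mathcal{M}$ be a finite dimensional C*-algebra with $\dim(\mathcal{M}) \ge 2$, equipped with its tracial $\delta$-form $\psi$, and let $K_{\mathcal{M}} = (\mathcal{M}, \psi, A, S)$ be the irreflexive complete quantum graph on $(\mathcal{M}, \psi)$, i.e. $A = \delta^2 \psi(\cdot)\mathbb{1} - I$. Then $\chi_q(K_{\mathcal{M}}) = \dim(\mathcal{M})$ and all of the following five lower bounds for $\chi_q(K_{\mathcal{M}})$ are tight: \[ 1 + \frac{\lambda_{\max}}{|\lambda_{\min}|} = 1 + \frac{\dim(S)}{\dim(S) - \dim(\mathcal{M})\gamma_{\min}} = 1 + \max\left\{\frac{s^+}{s^-}, \frac{s^-}{s^+}\right\} = 1 + \max\left\{\frac{n^+}{n^-}, \frac{n^-}{n^+}\right\} = 1 + \frac{\lambda_{\max}}{\lambda_{\max} - \gamma_{\max} + \theta_{\max}} = \dim(\mathcal{M}) = \chi_q(K_{\mathcal{M}}). \] Here $\lambda_{\max}, \lambda_{\min}$ are the maximum and minimum eigenvalues of $A$; $s^+, s^-$ are the sums of the squares of the positive and of the negative eigenvalues of $A$ (with multiplicity); $n^+, n^-$ are the numbers of positive and negative eigenvalues of $A$ (with multiplicity); $\gamma_{\max}, \gamma_{\min}$ are the maximum and minimum eigenvalues of the signless Laplacian $Q$; and $\theta_{\max}$ is the maximum eigenvalue of the Laplacian $L$.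
   Context: Quantum graph. $\mathcal{M} \cong \bigoplus_{i=1}^N M_{n_i}$ is a finite dimensional C*-algebra with unit $\mathbb{1}$, equipped with its unique tracial $\delta$-form $\psi = \frac{1}{\dim \mathcal{M}} \bigoplus_{i=1}^N n_i \mathrm{Tr}(\cdot)$, for which $\delta^2 = \dim(\mathcal{M})$. $L^2(\mathcal{M})$ is $\mathcal{M}$ with inner product $\langle x, y\rangle = \psi(y^*x)$; $\mathcal{M} \subseteq B(L^2(\mathcal{M}))$ acts by left multiplication, and $\mathcal{M}'$ is its commutant in $B(L^2(\mathcal{M}))$. A quantum graph on $\mathcal{M}$ is a linear subspace $S \subseteq B(L^2(\mathcal{M}))$ closed under adjoint with $\mathcal{M}' S \mathcal{M}' \subseteq S$. It is irreflexive if $S \subseteq (\mathcal{M}')^\perp$ (orthogonality for the trace inner product). The quantum adjacency matrix $A$ on $L^2(\mathcal{M})$ and the space $S$ determine each other by: the map $X \mapsto \delta^{-2} m(A \otimes X) m^*$ on $B(L^2(\mathcal{M}))$ is the orthogonal projection (for the trace inner product) onto $S$, where $m : \mathcal{M}\otimes\mathcal{M} \to \mathcal{M}$ is multiplication and $m^*$ is its adjoint as an operator $L^2(\mathcal{M}) \otimes L^2(\mathcal{M}) \to L^2(\mathcal{M})$. Degree matrix and Laplacians. The quantum degree matrix $D \in B(L^2(\mathcal{M}))$ is $D(x) = x\,(A\mathbb{1})$. The Laplacian is $L = D - A$ and the signless Laplacian is $Q = D + A$. Coloring. A quantum $c$-coloring of an irreflexive quantum graph consists of a finite dimensional von Neumann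 algebra $\mathcal{N}$ with a faithful trace and projections $P_1, \dots, P_c \in \mathcal{M} \otimes \mathcal{N}$ with $\sum_{a=1}^c P_a = I_{\mathcal{M} \otimes \mathcal{N}}$ and $P_a (X \otimes I_{\mathcal{N}}) P_a = 0$ for all $X \in S$ and $1 \le a \le c$. $\chi_q$ is the least $c$ for which a quantum $c$-coloring exists. *)

theory Defs
  imports Complex_Main "HOL-Library.Function_Algebras" "HOL-Library.Extended_Nat"
begin

section \<open>Finite dimensional complex spaces and operators\<close>

text \<open>
  Vectors are functions to \<^typ>\<open>complex\<close> supported on a finite index set. An operator is a
  linear map between two such spaces, extended by the value 0 to functions outside its domain
  space, so that operators are equal iff they agree on their domain. Addition is pointwise
  (\<^theory>\<open>HOL-Library.Function_Algebras\<close>).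
\<close>

type_synonym 'a cvec = "'a \<Rightarrow> complex"
type_synonym ('a, 'b) op = "'a cvec \<Rightarrow> 'b cvec"
type_synonym 'a form = "'a cvec \<Rightarrow> 'a cvec \<Rightarrow> complex"

definition cscale :: "complex \<Rightarrow> 'a cvec \<Rightarrow> 'a cvec" where
  "cscale c x = (\<lambda>p. c * x p)"

definition oscale :: "complex \<Rightarrow> ('a, 'b) op \<Rightarrow> ('a, 'b) op" where
  "oscale c T = (\<lambda>x. cscale c (T x))"

global_interpretation cvec: vector_space cscale
  by unfold_locales (auto simp: cscale_def fun_eq_iff algebra_simps)

global_interpretation cop: vector_space oscale
  by unfold_locales (auto simp: oscale_def cscale_def fun_eq_iff algebra_simps)

definition cvecs :: "'a set \<Rightarrow> 'a cvec set" where
  "cvecs I = {x. \<forall>p. p \<notin> I \<longrightarrow> x p = 0}"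

definition ket :: "'a \<Rightarrow> 'a cvec" where
  "ket p = (\<lambda>q. if q = p then 1 else 0)"

definition ops :: "'a set \<Rightarrow> 'b set \<Rightarrow> ('a, 'b) op set" where
  "ops I J = {T. (\<forall>x\<in>cvecs I. T x \<in> cvecs J) \<and>
     (\<forall>x\<in>cvecs I. \<forall>y\<in>cvecs I. T (x + y) = T x + T y) \<and>
     (\<forall>c. \<forall>x\<in>cvecs I. T (cscale c x) = cscale c (T x)) \<and>
     (\<forall>x. x \<notin> cvecs I \<longrightarrow> T x = 0)}"

definition id_op :: "'a set \<Rightarrow> ('a, 'a) op" where
  "id_op I = (\<lambda>x. if x \<in> cvecs I then x else 0)"

definition op_trace :: "'a set \<Rightarrow> ('a, 'a) op \<Rightarrow> complex" where
  "op_trace I T = (\<Sum>p\<in>I. T (ket p) p)"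

definition std_form :: "'a set \<Rightarrow> 'a form" where
  "std_form I x y = (\<Sum>p\<in>I. x p * cnj (y p))"

definition adj :: "'a set \<Rightarrow> 'a form \<Rightarrow> 'b set \<Rightarrow> 'b form \<Rightarrow> ('a, 'b) op \<Rightarrow> ('b, 'a) op" where
  "adj I g J h T = (THE T'. T' \<in> ops J I \<and>
     (\<forall>x\<in>cvecs I. \<forall>y\<in>cvecs J. h (T x) y = g x (T' y)))"

definition ten_vec :: "'a cvec \<Rightarrow> 'b cvec \<Rightarrow> ('a \<times> 'b) cvec" where
  "ten_vec x y = (\<lambda>(p, q). x p * y q)"

text \<open>The tensor product of operators and of inner products, by (sesqui)linear extension from
  the product basis vectors \<^term>\<open>ten_vec (ket p) (ket q) = ket (p, q)\<close>.\<close>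

definition ten_op :: "'a set \<Rightarrow> 'b set \<Rightarrow> ('a, 'c) op \<Rightarrow> ('b, 'd) op \<Rightarrow> ('a \<times> 'b, 'c \<times> 'd) op" where
  "ten_op I J T U = (\<lambda>z. if z \<in> cvecs (I \<times> J)
     then \<Sum>p\<in>I. \<Sum>q\<in>J. cscale (z (p, q)) (ten_vec (T (ket p)) (U (ket q))) else 0)"

definition ten_form :: "'a set \<Rightarrow> 'b set \<Rightarrow> 'a form \<Rightarrow> 'b form \<Rightarrow> ('a \<times> 'b) form" where
  "ten_form I J g h z w = (\<Sum>p\<in>I. \<Sum>q\<in>J. \<Sum>p'\<in>I. \<Sum>q'\<in>J.
     z (p, q) * cnj (w (p', q')) * g (ket p) (ket p') * h (ket q) (ket q'))"


section \<open>The C*-algebra and its tracial delta-form\<close>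

text \<open>
  The list \<open>ns\<close> of (positive) block sizes describes the direct sum of the full matrix algebras of
  sizes \<open>ns ! i\<close>; the value of an element at \<open>(i, j, k)\<close> is the \<open>(j, k)\<close> entry of its \<open>i\<close>-th block.
\<close>

type_synonym midx = "nat \<times> nat \<times> nat"

definition midx :: "nat list \<Rightarrow> midx set" where
  "midx ns = {(i, j, k). i < length ns \<and> j < ns ! i \<and> k < ns ! i}"

definition malg :: "nat list \<Rightarrow> midx cvec set" where
  "malg ns = cvecs (midx ns)"

definition mmult :: "nat list \<Rightarrow> midx cvec \<Rightarrow> midx cvec \<Rightarrow> midx cvec" where
  "mmult ns x y = (\<lambda>(i, j, k). \<Sum>l<ns ! i. x (i, j, l) * y (i, l, k))"

definition mstar :: "midx cvec \<Rightarrow> midx cvec" where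
  "mstar x = (\<lambda>(i, j, k). cnj (x (i, k, j)))"

definition mone :: "nat list \<Rightarrow> midx cvec" where
  "mone ns = (\<lambda>(i, j, k). if (i, j, k) \<in> midx ns \<and> j = k then 1 else 0)"

definition mdim :: "nat list \<Rightarrow> nat" where
  "mdim ns = cvec.dim (malg ns)"

definition delta :: "nat list \<Rightarrow> real" where
  "delta ns = sqrt (real (mdim ns))"

definition psi :: "nat list \<Rightarrow> midx cvec \<Rightarrow> complex" where
  "psi ns x = (1 / of_nat (mdim ns)) * (\<Sum>i<length ns. of_nat (ns ! i) * (\<Sum>j<ns ! i. x (i, j, j)))"

definition l2_form :: "nat list \<Rightarrow> midx form" where
  "l2_form ns x y = psi ns (mmult ns (mstar y) x)"

definition bl2 :: "nat list \<Rightarrow> (midx, midx) op set" where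
  "bl2 ns = ops (midx ns) (midx ns)"

definition l2_adj :: "nat list \<Rightarrow> (midx, midx) op \<Rightarrow> (midx, midx) op" where
  "l2_adj ns T = adj (midx ns) (l2_form ns) (midx ns) (l2_form ns) T"

definition trace_form :: "nat list \<Rightarrow> (midx, midx) op \<Rightarrow> (midx, midx) op \<Rightarrow> complex" where
  "trace_form ns X Y = op_trace (midx ns) (l2_adj ns Y \<circ> X)"

definition lmul :: "nat list \<Rightarrow> midx cvec \<Rightarrow> (midx, midx) op" where
  "lmul ns x = (\<lambda>y. if y \<in> malg ns then mmult ns x y else 0)"

definition mcomm :: "nat list \<Rightarrow> (midx, midx) op set" where
  "mcomm ns = {T \<in> bl2 ns. \<forall>x\<in>malg ns. T \<circ> lmul ns x = lmul ns x \<circ> T}"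

definition mult_op :: "nat list \<Rightarrow> (midx \<times> midx, midx) op" where
  "mult_op ns = (\<lambda>z. if z \<in> cvecs (midx ns \<times> midx ns)
     then \<Sum>p\<in>midx ns. \<Sum>q\<in>midx ns. cscale (z (p, q)) (mmult ns (ket p) (ket q)) else 0)"

definition comult_op :: "nat list \<Rightarrow> (midx, midx \<times> midx) op" where
  "comult_op ns = adj (midx ns \<times> midx ns) (ten_form (midx ns) (midx ns) (l2_form ns) (l2_form ns))
     (midx ns) (l2_form ns) (mult_op ns)"


section \<open>Quantum graphs\<close>

definition quantum_graph_space :: "nat list \<Rightarrow> (midx, midx) op set \<Rightarrow> bool" where
  "quantum_graph_space ns S \<longleftrightarrow> S \<subseteq> bl2 ns \<and> cop.subspace S \<and> (\<forall>X\<in>S. l2_adj ns X \<in> S) \<and>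
     (\<forall>R\<in>mcomm ns. \<forall>X\<in>S. \<forall>T\<in>mcomm ns. R \<circ> X \<circ> T \<in> S)"

definition irreflexive_space :: "nat list \<Rightarrow> (midx, midx) op set \<Rightarrow> bool" where
  "irreflexive_space ns S \<longleftrightarrow> (\<forall>X\<in>S. \<forall>T\<in>mcomm ns. trace_form ns X T = 0)"

definition adjacency_map :: "nat list \<Rightarrow> (midx, midx) op \<Rightarrow> (midx, midx) op \<Rightarrow> (midx, midx) op" where
  "adjacency_map ns A X = oscale (1 / (complex_of_real (delta ns))\<^sup>2)
     (mult_op ns \<circ> ten_op (midx ns) (midx ns) A X \<circ> comult_op ns)"

definition orth_projection_onto ::
  "nat list \<Rightarrow> ((midx, midx) op \<Rightarrow> (midx, midx) op) \<Rightarrow> (midx, midx) op set \<Rightarrow> bool" where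
  "orth_projection_onto ns F S \<longleftrightarrow>
     (\<forall>X\<in>bl2 ns. F X \<in> S \<and> (\<forall>Y\<in>S. trace_form ns (X - F X) Y = 0))"

definition quantum_graph :: "nat list \<Rightarrow> (midx, midx) op \<Rightarrow> (midx, midx) op set \<Rightarrow> bool" where
  "quantum_graph ns A S \<longleftrightarrow> A \<in> bl2 ns \<and> quantum_graph_space ns S \<and>
     orth_projection_onto ns (adjacency_map ns A) S"

definition complete_adjacency :: "nat list \<Rightarrow> (midx, midx) op" where
  "complete_adjacency ns = (\<lambda>x. if x \<in> malg ns
     then cscale ((complex_of_real (delta ns))\<^sup>2 * psi ns x) (mone ns) - x else 0)"

definition degree_op :: "nat list \<Rightarrow> (midx, midx) op \<Rightarrow> (midx, midx) op" where
  "degree_op ns A = (\<lambda>x. if x \<in> malg ns then mmult ns x (A (mone ns)) else 0)"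

definition laplacian :: "nat list \<Rightarrow> (midx, midx) op \<Rightarrow> (midx, midx) op" where
  "laplacian ns A = degree_op ns A - A"

definition signless_laplacian :: "nat list \<Rightarrow> (midx, midx) op \<Rightarrow> (midx, midx) op" where
  "signless_laplacian ns A = degree_op ns A + A"


section \<open>Spectral quantities\<close>

text \<open>These are used for self-adjoint operators only, whose eigenvalues are all real and have
  equal algebraic and geometric multiplicities.\<close>

definition eigenspace :: "nat list \<Rightarrow> (midx, midx) op \<Rightarrow> real \<Rightarrow> midx cvec set" where
  "eigenspace ns T r = {x \<in> malg ns. T x = cscale (complex_of_real r) x}"

definition eigvals :: "nat list \<Rightarrow> (midx, midx) op \<Rightarrow> real set" where
  "eigvals ns T = {r. \<exists>x\<in>eigenspace ns T r. x \<noteq> 0}"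

definition eig_mult :: "nat list \<Rightarrow> (midx, midx) op \<Rightarrow> real \<Rightarrow> nat" where
  "eig_mult ns T r = cvec.dim (eigenspace ns T r)"

definition eig_max :: "nat list \<Rightarrow> (midx, midx) op \<Rightarrow> real" where
  "eig_max ns T = Max (eigvals ns T)"

definition eig_min :: "nat list \<Rightarrow> (midx, midx) op \<Rightarrow> real" where
  "eig_min ns T = Min (eigvals ns T)"

definition sq_pos :: "nat list \<Rightarrow> (midx, midx) op \<Rightarrow> real" where
  "sq_pos ns T = (\<Sum>r\<in>{r \<in> eigvals ns T. r > 0}. real (eig_mult ns T r) * r\<^sup>2)"

definition sq_neg :: "nat list \<Rightarrow> (midx, midx) op \<Rightarrow> real" where
  "sq_neg ns T = (\<Sum>r\<in>{r \<in> eigvals ns T. r < 0}. real (eig_mult ns T r) * r\<^sup>2)"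

definition num_pos :: "nat list \<Rightarrow> (midx, midx) op \<Rightarrow> nat" where
  "num_pos ns T = (\<Sum>r\<in>{r \<in> eigvals ns T. r > 0}. eig_mult ns T r)"

definition num_neg :: "nat list \<Rightarrow> (midx, midx) op \<Rightarrow> nat" where
  "num_neg ns T = (\<Sum>r\<in>{r \<in> eigvals ns T. r < 0}. eig_mult ns T r)"


section \<open>Quantum colorings\<close>

text \<open>
  A finite dimensional von Neumann algebra is a unital *-subalgebra of the operators on a nonzero
  finite dimensional Hilbert space, here the functions on \<open>{..<k}\<close>. The condition \<open>0 < k\<close> is
  essential: over the zero algebra the empty family would be a coloring.
\<close>

definition std_adj :: "nat \<Rightarrow> (nat, nat) op \<Rightarrow> (nat, nat) op" where
  "std_adj k T = adj {..<k} (std_form {..<k}) {..<k} (std_form {..<k}) T"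

definition fd_vn_algebra :: "nat \<Rightarrow> (nat, nat) op set \<Rightarrow> bool" where
  "fd_vn_algebra k N \<longleftrightarrow> 0 < k \<and> N \<subseteq> ops {..<k} {..<k} \<and> cop.subspace N \<and> id_op {..<k} \<in> N \<and>
     (\<forall>X\<in>N. \<forall>Y\<in>N. X \<circ> Y \<in> N) \<and> (\<forall>X\<in>N. std_adj k X \<in> N)"

definition faithful_trace :: "nat \<Rightarrow> (nat, nat) op set \<Rightarrow> ((nat, nat) op \<Rightarrow> complex) \<Rightarrow> bool" where
  "faithful_trace k N \<tau> \<longleftrightarrow>
     (\<forall>X\<in>N. \<forall>Y\<in>N. \<tau> (X + Y) = \<tau> X + \<tau> Y) \<and>
     (\<forall>c. \<forall>X\<in>N. \<tau> (oscale c X) = c * \<tau> X) \<and>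
     (\<forall>X\<in>N. \<forall>Y\<in>N. \<tau> (X \<circ> Y) = \<tau> (Y \<circ> X)) \<and>
     (\<forall>X\<in>N. \<tau> (std_adj k X \<circ> X) \<in> \<real> \<and> 0 \<le> Re (\<tau> (std_adj k X \<circ> X))) \<and>
     (\<forall>X\<in>N. \<tau> (std_adj k X \<circ> X) = 0 \<longrightarrow> X = 0)"

text \<open>The algebraic tensor product of the two algebras, acting on the tensor product of
  \<open>L\<^sup>2\<close> of the first algebra with the Hilbert space of the second.\<close>

definition tensor_alg :: "nat list \<Rightarrow> nat \<Rightarrow> (nat, nat) op set \<Rightarrow> (midx \<times> nat, midx \<times> nat) op set" where
  "tensor_alg ns k N = cop.span {ten_op (midx ns) {..<k} (lmul ns x) Y |x Y. x \<in> malg ns \<and> Y \<in> N}"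

definition tensor_adj :: "nat list \<Rightarrow> nat \<Rightarrow> (midx \<times> nat, midx \<times> nat) op \<Rightarrow> (midx \<times> nat, midx \<times> nat) op" where
  "tensor_adj ns k T =
     adj (midx ns \<times> {..<k}) (ten_form (midx ns) {..<k} (l2_form ns) (std_form {..<k}))
         (midx ns \<times> {..<k}) (ten_form (midx ns) {..<k} (l2_form ns) (std_form {..<k})) T"

definition quantum_coloring :: "nat list \<Rightarrow> (midx, midx) op set \<Rightarrow> nat \<Rightarrow> nat \<Rightarrow> (nat, nat) op set
    \<Rightarrow> (nat \<Rightarrow> (midx \<times> nat, midx \<times> nat) op) \<Rightarrow> bool" where
  "quantum_coloring ns S c k N P \<longleftrightarrow>
     (\<forall>a\<in>{1..c}. P a \<in> tensor_alg ns k N \<and> P a \<circ> P a = P a \<and> tensor_adj ns k (P a) = P a) \<and>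
     (\<Sum>a\<in>{1..c}. P a) = id_op (midx ns \<times> {..<k}) \<and>
     (\<forall>X\<in>S. \<forall>a\<in>{1..c}. P a \<circ> ten_op (midx ns) {..<k} X (id_op {..<k}) \<circ> P a = 0)"

definition quantum_colorable :: "nat list \<Rightarrow> (midx, midx) op set \<Rightarrow> nat \<Rightarrow> bool" where
  "quantum_colorable ns S c \<longleftrightarrow>
     (\<exists>k N \<tau> P. fd_vn_algebra k N \<and> faithful_trace k N \<tau> \<and> quantum_coloring ns S c k N P)"

text \<open>The infimum over no admissible number of colors is \<open>\<infinity>\<close>; a finite value is attained.\<close>

definition chi_q :: "nat list \<Rightarrow> (midx, midx) op set \<Rightarrow> enat" where
  "chi_q ns S = Inf {enat c |c. quantum_colorable ns S c}"

end

theory Submission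
  imports Defs
begin

text \<open>
  Write \<open>d\<close> for the dimension of the algebra, so that \<open>\<delta>\<^sup>2 = d\<close>. For the complete graph the
  operators \<open>A\<close>, \<open>L\<close> and \<open>Q\<close> all have the form \<open>x \<mapsto> a x + b \<psi>(x) 1\<close>, because
  \<open>A 1 = (d - 1) 1\<close> makes the degree operator a scalar. Since \<open>\<psi>(1) = 1\<close>, such an operator has
  the eigenvalue \<open>a + b\<close> on the line through the unit and \<open>a\<close> on the kernel of \<open>\<psi>\<close>, of
  dimension \<open>d - 1\<close> (\<open>spectrum_rank_one_perturbation\<close>). Hence the spectra of \<open>A\<close>, \<open>L\<close> and \<open>Q\<close>
  are \<open>{-1, d - 1}\<close>, \<open>{d, 0}\<close> and \<open>{d - 2, 2 d - 2}\<close>.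

  For the dimension of \<open>S\<close>, the map \<open>X \<mapsto> \<delta>\<^sup>-\<^sup>2 m(A \<otimes> X) m\<^sup>*\<close> is \<open>X \<mapsto> X - E X\<close>, where
  \<open>E X\<close> has the entries \<open>slice_trace\<close> of \<open>X\<close> up to factors; in fact \<open>E\<close> is the conditional
  expectation onto the commutant. So the projection condition puts every \<open>X\<close> with vanishing slice
  traces into \<open>S\<close>, and irreflexivity, tested against right multiplications, gives the converse
  (\<open>complete_graph_space\<close>). These are \<open>d\<close> independent linear conditions on a space of dimension
  \<open>d\<^sup>2\<close>, so \<open>dim S = d\<^sup>2 - d\<close>. With these values all five fractions equal \<open>d - 1\<close>.

  The quantum chromatic number is \<open>d\<close> for the following reasons.

  Lower bound (\<open>coloring_lower_bound\<close>): \<open>A = d p - I\<close> lies in \<open>S\<close>, where \<open>p\<close> is the orthogonal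
  projection onto the line of the unit. Hence a color \<open>P\<close> satisfies
  \<open>P (p \<otimes> I) P = P / d\<close>. Let \<open>v = 1 \<otimes> e\<close> for a unit vector \<open>e\<close> and \<open>r = \<langle>P v, v\<rangle>\<close>. As
  \<open>p \<otimes> I\<close> dominates the projection onto \<open>v\<close>, it follows that \<open>r\<^sup>2 \<le> r / d\<close>, so \<open>r \<le> 1 / d\<close>. The
  numbers \<open>r\<close> sum to 1 over the colors, so there are at least \<open>d\<close> of them.

  Upper bound (\<open>complete_graph_colorable\<close>): an orthonormal basis of maximally entangled vectors of
  \<open>\<complex>\<^sup>n \<otimes> \<complex>\<^sup>n\<close>, obtained from the \<open>n\<^sup>2\<close> Weyl unitaries, gives \<open>n\<^sup>2\<close> rank one projections in
  \<open>M\<^sub>n \<otimes> M\<^sub>n\<close> that compress \<open>X \<otimes> I\<close> to a multiple of the trace of \<open>X\<close>. Taking for the second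
  algebra the matrices of size \<open>k\<close>, the product of all block sizes, every block embeds its own
  basis of colors, and a color of one block vanishes on all other blocks. There are
  \<open>\<Sum>\<^sub>i n\<^sub>i\<^sup>2 = d\<close> colors in total.

  All computations are done with matrix entries. The inner products involved are diagonal in the
  standard basis with positive weights, so that one formula (\<open>adj_weighted\<close>) covers every adjoint.
\<close>

section \<open>Dimension of a common kernel\<close>

context vector_space
begin

lemma functional_zero_on_span:
  fixes f :: "'b \<Rightarrow> 'a"
  assumes "\<And>x y. f (x + y) = f x + f y" and "\<And>c x. f (scale c x) = c * f x"
    and "\<And>x. x \<in> B \<Longrightarrow> f x = 0" and "x \<in> span B"
  shows "f x = 0"
  using assms(4)
proof (induction rule: span_induct_alt)
  case base
  show ?case using assms(2)[of 0 0] by simp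
next
  case (step c x y)
  then show ?case using assms(1,2,3) by simp
qed

lemma functional_sum:
  fixes f :: "'b \<Rightarrow> 'a"
  assumes "\<And>x y. f (x + y) = f x + f y" and "\<And>c x. f (scale c x) = c * f x"
  shows "f (\<Sum>i\<in>I. g i) = (\<Sum>i\<in>I. f (g i))"
proof -
  have "f 0 = 0" using assms(2)[of 0 0] by simp
  then show ?thesis by (induction I rule: infinite_finite_induct) (auto simp: assms)
qed

lemma functional_diff:
  fixes f :: "'b \<Rightarrow> 'a"
  assumes "\<And>x y. f (x + y) = f x + f y"
  shows "f (x - y) = f x - f y"
  using assms[of "x - y" y] by (simp add: algebra_simps)

text \<open>Subtracting the expansion in the dual system is the projection onto the common kernel along
  the span of the \<open>b k\<close>.\<close>

lemma dual_expansion_in_kernel: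
  fixes f :: "'k \<Rightarrow> 'b \<Rightarrow> 'a"
  assumes "finite K" and V: "subspace V" and bV: "\<And>k. k \<in> K \<Longrightarrow> b k \<in> V"
    and add: "\<And>k x y. f k (x + y) = f k x + f k y"
    and hom: "\<And>k c x. f k (scale c x) = c * f k x"
    and dual: "\<And>k k'. k \<in> K \<Longrightarrow> k' \<in> K \<Longrightarrow> f k (b k') = (if k = k' then 1 else 0)"
    and "v \<in> V"
  shows "v - (\<Sum>k\<in>K. scale (f k v) (b k)) \<in> {v \<in> V. \<forall>k\<in>K. f k v = 0}"
proof -
  have "f k (v - (\<Sum>k\<in>K. scale (f k v) (b k))) = 0" if "k \<in> K" for k
  proof -
    have "f k (\<Sum>k\<in>K. scale (f k v) (b k)) = (\<Sum>k'\<in>K. f k' v * f k (b k'))"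
      by (simp add: functional_sum[of "f k", OF add hom] hom)
    also have "\<dots> = (\<Sum>k'\<in>K. if k = k' then f k' v else 0)"
      using that by (intro sum.cong) (auto simp: dual)
    also have "\<dots> = f k v" using that \<open>finite K\<close> by simp
    finally show ?thesis by (simp add: functional_diff[of "f k", OF add])
  qed
  moreover have "v - (\<Sum>k\<in>K. scale (f k v) (b k)) \<in> V"
    using assms by (intro subspace_diff subspace_sum subspace_scale) auto
  ultimately show ?thesis by simp
qed

text \<open>Adding the vectors \<open>b k\<close> one at a time to a basis of the kernel keeps it independent:
  the functional \<open>f k\<close> vanishes on the span of everything added before \<open>b k\<close>, but not on \<open>b k\<close>.\<close>

lemma dim_common_kernel:
  fixes f :: "'k \<Rightarrow> 'b \<Rightarrow> 'a"
  assumes "finite K" and V: "subspace V" and "finite F" and "V \<subseteq> span F"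
    and bV: "\<And>k. k \<in> K \<Longrightarrow> b k \<in> V"
    and add: "\<And>k x y. f k (x + y) = f k x + f k y"
    and hom: "\<And>k c x. f k (scale c x) = c * f k x"
    and dual: "\<And>k k'. k \<in> K \<Longrightarrow> k' \<in> K \<Longrightarrow> f k (b k') = (if k = k' then 1 else 0)"
  shows "dim V = dim {v \<in> V. \<forall>k\<in>K. f k v = 0} + card K"
proof -
  define U where "U = {v \<in> V. \<forall>k\<in>K. f k v = 0}"
  obtain B where B: "B \<subseteq> U" "independent B" "U \<subseteq> span B" "card B = dim U"
    by (rule basis_exists)
  have finB: "finite B"
    using independent_span_bound[OF \<open>finite F\<close> B(2)] B(1) \<open>V \<subseteq> span F\<close> by (auto simp: U_def)
  have indep: "independent (B \<union> b ` K') \<and> card (B \<union> b ` K') = card B + card K'"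
    if "finite K'" "K' \<subseteq> K" for K'
    using that
  proof (induction rule: finite_induct)
    case empty
    then show ?case using B by simp
  next
    case (insert k K')
    have "f k x = 0" if "x \<in> B \<union> b ` K'" for x
      using that insert.hyps insert.prems B(1) by (auto simp: U_def dual)
    then have "f k x = 0" if "x \<in> span (B \<union> b ` K')" for x
      using functional_zero_on_span[of "f k", OF add hom _ that] by blast
    moreover have "f k (b k) \<noteq> 0" using insert.prems by (simp add: dual)
    ultimately have new: "b k \<notin> span (B \<union> b ` K')" by blast
    then have "b k \<notin> B \<union> b ` K'" using span_base[of "b k"] by metis
    moreover have "independent (B \<union> b ` K')" "card (B \<union> b ` K') = card B + card K'"
      using insert.IH insert.prems by auto
    ultimately show ?case
      using independent_insertI[OF new] insert.hyps finB by simp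
  qed
  have "V \<subseteq> span (B \<union> b ` K)"
  proof
    fix v assume "v \<in> V"
    define s where "s = (\<Sum>k\<in>K. scale (f k v) (b k))"
    have "v - s \<in> U"
      unfolding U_def s_def using assms \<open>v \<in> V\<close> by (intro dual_expansion_in_kernel) auto
    then have "v - s \<in> span (B \<union> b ` K)"
      using B(3) span_mono[of B "B \<union> b ` K"] by blast
    moreover have "s \<in> span (B \<union> b ` K)"
      unfolding s_def by (intro span_sum span_scale span_base) auto
    ultimately have "v - s + s \<in> span (B \<union> b ` K)" by (rule span_add)
    then show "v \<in> span (B \<union> b ` K)" by simp
  qed
  moreover have "B \<union> b ` K \<subseteq> V" using B(1) bV by (auto simp: U_def)
  ultimately have "dim V = card (B \<union> b ` K)"
    using indep[OF \<open>finite K\<close>] by (metis basis_card_eq_dim order_refl)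
  then show ?thesis using indep[OF \<open>finite K\<close>] B(4) by (simp add: U_def)
qed

text \<open>The case of a trivial common kernel: the dual expansion of every vector is then exact, so the
  \<open>b k\<close> span the space.\<close>

lemma dim_dual_basis:
  fixes f :: "'k \<Rightarrow> 'b \<Rightarrow> 'a"
  assumes "finite K" and V: "subspace V" and bV: "\<And>k. k \<in> K \<Longrightarrow> b k \<in> V"
    and add: "\<And>k x y. f k (x + y) = f k x + f k y"
    and hom: "\<And>k c x. f k (scale c x) = c * f k x"
    and dual: "\<And>k k'. k \<in> K \<Longrightarrow> k' \<in> K \<Longrightarrow> f k (b k') = (if k = k' then 1 else 0)"
    and sep: "\<And>v. v \<in> V \<Longrightarrow> (\<And>k. k \<in> K \<Longrightarrow> f k v = 0) \<Longrightarrow> v = 0"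
  shows "V \<subseteq> span (b ` K)" and "dim V = card K"
proof -
  show sub: "V \<subseteq> span (b ` K)"
  proof
    fix v assume "v \<in> V"
    then have "v - (\<Sum>k\<in>K. scale (f k v) (b k)) = 0"
      using dual_expansion_in_kernel[of K V b f v] assms by blast
    then have "v = (\<Sum>k\<in>K. scale (f k v) (b k))" by simp
    also have "\<dots> \<in> span (b ` K)" by (intro span_sum span_scale span_base) auto
    finally show "v \<in> span (b ` K)" .
  qed
  have f0: "f k 0 = 0" for k using hom[of k 0 0] by simp
  have "{v \<in> V. \<forall>k\<in>K. f k v = 0} = {0}"
    using sep subspace_0[OF V] by (auto simp: f0)
  moreover have "dim {0} = 0" using dim_span[of "{}"] dim_eq_card_independent[of "{}"]
    by (simp add: independent_empty)
  ultimately show "dim V = card K"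
    using dim_common_kernel[of K V "b ` K" b f] sub assms by simp
qed

end


section \<open>Operators as matrices\<close>

text \<open>Operators vanish outside their domain space, so a matrix determines an operator only together
  with its two index sets.\<close>

definition mat_op :: "'a set \<Rightarrow> 'b set \<Rightarrow> ('b \<Rightarrow> 'a \<Rightarrow> complex) \<Rightarrow> ('a, 'b) op" where
  "mat_op I J m = (\<lambda>x. if x \<in> cvecs I then (\<lambda>p. if p \<in> J then \<Sum>q\<in>I. m p q * x q else 0) else 0)"

lemma sum_fun_apply: "(\<Sum>i\<in>I. g i) x = (\<Sum>i\<in>I. g i x)"
  for g :: "'i \<Rightarrow> 'a \<Rightarrow> 'b::comm_monoid_add"
  by (induction I rule: infinite_finite_induct) auto

lemma ket_in_cvecs [simp]: "ket p \<in> cvecs I \<longleftrightarrow> p \<in> I"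
  by (auto simp: ket_def cvecs_def)

lemma cvecs_zero [simp]: "0 \<in> cvecs I"
  by (simp add: cvecs_def)

lemma cvecs_add: "x \<in> cvecs I \<Longrightarrow> y \<in> cvecs I \<Longrightarrow> x + y \<in> cvecs I"
  by (simp add: cvecs_def)

lemma cvecs_scale: "x \<in> cvecs I \<Longrightarrow> cscale c x \<in> cvecs I"
  by (simp add: cvecs_def cscale_def)

lemma subspace_cvecs: "cvec.subspace (cvecs I)"
  unfolding cvec.subspace_def by (auto intro: cvecs_add cvecs_scale)

lemma cvecs_expand:
  assumes "finite I" "x \<in> cvecs I"
  shows "x = (\<Sum>p\<in>I. cscale (x p) (ket p))"
proof
  fix q
  have "(\<Sum>p\<in>I. cscale (x p) (ket p)) q = (\<Sum>p\<in>I. if q = p then x p else 0)"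
    unfolding sum_fun_apply by (intro sum.cong) (auto simp: cscale_def ket_def)
  also have "\<dots> = x q" using assms by (auto simp: cvecs_def)
  finally show "x q = (\<Sum>p\<in>I. cscale (x p) (ket p)) q" by simp
qed

lemma mat_op_in_ops: "mat_op I J m \<in> ops I J"
  unfolding ops_def mat_op_def
  by (auto simp: cvecs_add cvecs_scale fun_eq_iff cscale_def algebra_simps sum.distrib
      sum_distrib_left cvecs_def)

lemma mat_op_ket [simp]: "finite I \<Longrightarrow> p \<in> J \<Longrightarrow> q \<in> I \<Longrightarrow> mat_op I J m (ket q) p = m p q"
  by (simp add: mat_op_def, simp add: ket_def if_distrib cong: if_cong)

lemma ops_add: "T \<in> ops I J \<Longrightarrow> x \<in> cvecs I \<Longrightarrow> y \<in> cvecs I \<Longrightarrow> T (x + y) = T x + T y"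
  unfolding ops_def by blast

lemma ops_scale: "T \<in> ops I J \<Longrightarrow> x \<in> cvecs I \<Longrightarrow> T (cscale c x) = cscale c (T x)"
  by (simp add: ops_def)

lemma ops_sum:
  assumes "T \<in> ops I J" "finite K" "\<And>k. k \<in> K \<Longrightarrow> g k \<in> cvecs I"
  shows "(\<Sum>k\<in>K. g k) \<in> cvecs I \<and> T (\<Sum>k\<in>K. g k) = (\<Sum>k\<in>K. T (g k))"
  using assms(2,3)
proof (induction rule: finite_induct)
  case empty
  have "T 0 = 0"
    using ops_scale[OF assms(1) cvecs_zero, of 0] by simp
  then show ?case by (simp only: sum.empty cvecs_zero simp_thms)
next
  case (insert k K)
  have "sum g K \<in> cvecs I" "T (sum g K) = (\<Sum>k\<in>K. T (g k))" "g k \<in> cvecs I"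
    using insert by auto
  then show ?case
    using cvecs_add ops_add[OF assms(1)] by (simp only: sum.insert[OF insert.hyps] simp_thms)
qed

lemma ops_eq_mat_op:
  assumes "finite I" "T \<in> ops I J"
  shows "T = mat_op I J (\<lambda>p q. T (ket q) p)"
proof
  fix x
  show "T x = mat_op I J (\<lambda>p q. T (ket q) p) x"
  proof (cases "x \<in> cvecs I")
    case False
    then show ?thesis using assms by (simp add: ops_def mat_op_def)
  next
    case True
    have "T x = T (\<Sum>p\<in>I. cscale (x p) (ket p))" using cvecs_expand[OF assms(1) True] by simp
    also have "\<dots> = (\<Sum>p\<in>I. T (cscale (x p) (ket p)))"
      using ops_sum[OF assms(2) assms(1)] by (simp add: cvecs_scale)
    also have "\<dots> = (\<Sum>p\<in>I. cscale (x p) (T (ket p)))"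
      using assms(2) by (intro sum.cong) (auto simp: ops_def)
    finally have *: "T x = (\<Sum>p\<in>I. cscale (x p) (T (ket p)))" .
    have "T x \<in> cvecs J" using assms True by (simp add: ops_def)
    then show ?thesis
      using True by (auto simp: mat_op_def fun_eq_iff cvecs_def)
        (simp add: * sum_fun_apply cscale_def mult.commute)
  qed
qed

lemma mat_op_cong:
  "(\<And>p q. p \<in> J \<Longrightarrow> q \<in> I \<Longrightarrow> m p q = m' p q) \<Longrightarrow> mat_op I J m = mat_op I J m'"
  unfolding mat_op_def by (auto simp: fun_eq_iff intro!: sum.cong)

text \<open>The reason for working with entries: identities of operators reduce to identities of
  matrices.\<close>

lemma ops_eqI:
  assumes "finite I" "T \<in> ops I J" "T' \<in> ops I J"
    "\<And>p q. p \<in> J \<Longrightarrow> q \<in> I \<Longrightarrow> T (ket q) p = T' (ket q) p"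
  shows "T = T'"
  using ops_eq_mat_op[OF assms(1,2)] ops_eq_mat_op[OF assms(1,3)] mat_op_cong[of J I] assms(4)
  by (metis (no_types, lifting))

lemma mat_op_apply: "x \<in> cvecs I \<Longrightarrow> p \<in> J \<Longrightarrow> mat_op I J m x p = (\<Sum>q\<in>I. m p q * x q)"
  by (simp add: mat_op_def)

lemma ops_apply:
  assumes "finite I" "T \<in> ops I J" "x \<in> cvecs I" "p \<in> J"
  shows "T x p = (\<Sum>q\<in>I. T (ket q) p * x q)"
  by (subst ops_eq_mat_op[OF assms(1,2)]) (use assms in \<open>simp add: mat_op_apply\<close>)

lemma ops_closed: "T \<in> ops I J \<Longrightarrow> x \<in> cvecs I \<Longrightarrow> T x \<in> cvecs J"
  by (simp add: ops_def)

lemma ops_zero_outside: "T \<in> ops I J \<Longrightarrow> x \<notin> cvecs I \<Longrightarrow> T x = 0"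
  by (simp add: ops_def)

lemma ops_zero [simp]: "T \<in> ops I J \<Longrightarrow> T 0 = 0"
  using ops_sum[of T I J "{}"] by simp

lemma ops_comp: "T \<in> ops I J \<Longrightarrow> U \<in> ops J K \<Longrightarrow> U \<circ> T \<in> ops I K"
  using ops_zero[of U J K] unfolding ops_def by auto

lemma comp_ket:
  assumes "finite J" "T \<in> ops I J" "U \<in> ops J K" "q \<in> I" "p \<in> K"
  shows "(U \<circ> T) (ket q) p = (\<Sum>r\<in>J. U (ket r) p * T (ket q) r)"
  using ops_apply[OF assms(1,3) _ assms(5), of "T (ket q)"] assms ops_closed[OF assms(2)] by simp

lemma subspace_ops: "cop.subspace (ops I J)"
  unfolding cop.subspace_def ops_def
  by (auto simp: cvecs_add cvecs_scale oscale_def cvec.scale_right_distrib cvec.scale_left_commute)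

lemma id_op_comp:
  assumes "T \<in> ops I J"
  shows "id_op J \<circ> T = T"
proof
  fix x
  have "T x \<in> cvecs J"
  proof (cases "x \<in> cvecs I")
    case True
    then show ?thesis by (rule ops_closed[OF assms])
  next
    case False
    show ?thesis unfolding ops_zero_outside[OF assms False] by (rule cvecs_zero)
  qed
  then show "(id_op J \<circ> T) x = T x" by (simp add: id_op_def)
qed

lemma ten_op_eq_mat_op:
  assumes "finite I" "finite J" "T \<in> ops I K" "U \<in> ops J L"
  shows "ten_op I J T U =
    mat_op (I \<times> J) (K \<times> L) (\<lambda>(p, q) (p', q'). T (ket p') p * U (ket q') q)"
proof -
  have 0: "T (ket p') p * U (ket q') q = 0" if "p' \<in> I" "q' \<in> J" "(p, q) \<notin> K \<times> L" for p q p' q'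
  proof -
    have "T (ket p') \<in> cvecs K" "U (ket q') \<in> cvecs L"
      using ops_closed[OF assms(3)] ops_closed[OF assms(4)] that by simp_all
    then show ?thesis using that by (auto simp: cvecs_def)
  qed
  have "(\<Sum>p\<in>I. \<Sum>q\<in>J. cscale (z (p, q)) (ten_vec (T (ket p)) (U (ket q)))) (p, q) =
    (if (p, q) \<in> K \<times> L then \<Sum>(p', q')\<in>I \<times> J. T (ket p') p * U (ket q') q * z (p', q') else 0)"
    for z p q
  proof -
    have "(\<Sum>p\<in>I. \<Sum>q\<in>J. cscale (z (p, q)) (ten_vec (T (ket p)) (U (ket q)))) (p, q) =
      (\<Sum>(p', q')\<in>I \<times> J. T (ket p') p * U (ket q') q * z (p', q'))"
      by (simp add: sum_fun_apply cscale_def ten_vec_def sum.cartesian_product case_prod_unfold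
          mult.commute)
    moreover have "(\<Sum>(p', q')\<in>I \<times> J. T (ket p') p * U (ket q') q * z (p', q')) = 0"
      if "(p, q) \<notin> K \<times> L"
      by (rule sum.neutral) (use 0[OF _ _ that] in auto)
    ultimately show ?thesis by auto
  qed
  then show ?thesis
    unfolding ten_op_def mat_op_def by (auto simp: fun_eq_iff case_prod_unfold)
qed

lemma ten_op_in_ops:
  assumes "finite I" "finite J" "T \<in> ops I K" "U \<in> ops J L"
  shows "ten_op I J T U \<in> ops (I \<times> J) (K \<times> L)"
  by (simp add: ten_op_eq_mat_op[OF assms] mat_op_in_ops)

lemma ten_op_ket:
  assumes "finite I" "finite J" "T \<in> ops I K" "U \<in> ops J L"
    and "p \<in> K" "q \<in> L" "p' \<in> I" "q' \<in> J"
  shows "ten_op I J T U (ket (p', q')) (p, q) = T (ket p') p * U (ket q') q"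
  using assms by (simp add: ten_op_eq_mat_op)

lemma id_op_in_ops: "id_op I \<in> ops I I"
  unfolding id_op_def ops_def by (auto simp: cvecs_add cvecs_scale)

lemma id_op_ket: "q \<in> I \<Longrightarrow> id_op I (ket q) p = (if p = q then 1 else 0)"
  by (simp add: id_op_def) (simp add: ket_def)

lemma dim_cvecs:
  assumes "finite I"
  shows "cvec.dim (cvecs I) = card I" and "cvecs I \<subseteq> cvec.span (ket ` I)"
proof -
  have sep: "x = 0" if "x \<in> cvecs I" "\<And>p. p \<in> I \<Longrightarrow> x p = 0" for x :: "'a cvec"
    using that by (auto simp: cvecs_def fun_eq_iff)
  have dual: "ket q p = (if p = q then 1 else 0)" for p q :: 'a
    by (simp add: ket_def)
  show "cvec.dim (cvecs I) = card I"
    by (rule cvec.dim_dual_basis(2)[where b = ket and f = "\<lambda>p x. x p"])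
      (use assms sep subspace_cvecs in \<open>auto simp: cscale_def dual\<close>)
  show "cvecs I \<subseteq> cvec.span (ket ` I)"
    by (rule cvec.dim_dual_basis(1)[where b = ket and f = "\<lambda>p x. x p"])
      (use assms sep subspace_cvecs in \<open>auto simp: cscale_def dual\<close>)
qed

lemma dim_ops:
  assumes "finite I" "finite J"
  shows "cop.dim (ops I J) = card J * card I" and "\<exists>F. finite F \<and> ops I J \<subseteq> cop.span F"
proof -
  let ?b = "\<lambda>(p, q). mat_op I J (\<lambda>p' q'. if p' = p \<and> q' = q then 1 else 0)"
  let ?f = "\<lambda>(p, q) T. T (ket q) p :: complex"
  have sep: "T = 0" if "T \<in> ops I J" "\<And>k. k \<in> J \<times> I \<Longrightarrow> ?f k T = 0" for T
    using that by (intro ops_eqI[OF assms(1), of _ J] cop.subspace_0 subspace_ops) auto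
  have *: "ops I J \<subseteq> cop.span (?b ` (J \<times> I)) \<and> cop.dim (ops I J) = card (J \<times> I)"
    using cop.dim_dual_basis[of "J \<times> I" "ops I J" ?b ?f] assms sep
    by (auto simp: subspace_ops mat_op_in_ops oscale_def cscale_def)
  show "cop.dim (ops I J) = card J * card I" using * by (simp add: card_cartesian_product)
  show "\<exists>F. finite F \<and> ops I J \<subseteq> cop.span F"
    by (rule exI[of _ "?b ` (J \<times> I)"], rule conjI[OF finite_imageI conjunct1[OF *]])
      (use assms in simp)
qed


section \<open>Weighted inner products and adjoints\<close>

definition weighted_form :: "'a set \<Rightarrow> ('a \<Rightarrow> real) \<Rightarrow> 'a form" where
  "weighted_form I w x y = (\<Sum>p\<in>I. complex_of_real (w p) * x p * cnj (y p))"

lemma std_form_weighted: "std_form I = weighted_form I (\<lambda>_. 1)"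
  by (simp add: std_form_def weighted_form_def fun_eq_iff)

lemma weighted_form_ket:
  "finite I \<Longrightarrow> p \<in> I \<Longrightarrow> weighted_form I w x (ket p) = of_real (w p) * x p"
  unfolding weighted_form_def ket_def by (simp add: if_distrib cong: if_cong)

lemma ten_form_weighted:
  fixes I :: "'a set" and J :: "'b set"
  assumes "finite I" "finite J"
  shows "ten_form I J (weighted_form I w) (weighted_form J v) =
    weighted_form (I \<times> J) (\<lambda>(p, q). w p * v q)"
proof (intro ext)
  fix x y :: "('a \<times> 'b) cvec"
  have "ten_form I J (weighted_form I w) (weighted_form J v) x y =
    (\<Sum>p\<in>I. \<Sum>q\<in>J. \<Sum>p'\<in>I. \<Sum>q'\<in>J.
      if q' = q then if p' = p then complex_of_real (w p * v q) * x (p, q) * cnj (y (p, q)) else 0 else 0)"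
    unfolding ten_form_def
  proof (intro sum.cong refl)
    fix p q p' q' assume "p \<in> I" "q \<in> J" "p' \<in> I" "q' \<in> J"
    then show "x (p, q) * cnj (y (p', q')) * weighted_form I w (ket p) (ket p') *
        weighted_form J v (ket q) (ket q') =
      (if q' = q then if p' = p then complex_of_real (w p * v q) * x (p, q) * cnj (y (p, q)) else 0 else 0)"
      using assms by (simp add: weighted_form_ket) (simp add: ket_def)
  qed
  also have "\<dots> = (\<Sum>p\<in>I. \<Sum>q\<in>J. complex_of_real (w p * v q) * x (p, q) * cnj (y (p, q)))"
    using assms by simp
  also have "\<dots> = weighted_form (I \<times> J) (\<lambda>(p, q). w p * v q) x y"
    unfolding weighted_form_def sum.cartesian_product by (intro sum.cong) auto
  finally show "ten_form I J (weighted_form I w) (weighted_form J v) x y =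
    weighted_form (I \<times> J) (\<lambda>(p, q). w p * v q) x y" .
qed

text \<open>In the standard basis the adjoint is the conjugate transpose rescaled by the ratio of the
  weights. Positivity of the weights on the domain makes the form nondegenerate, so that the
  definite description of the adjoint has this operator as its only candidate.\<close>

lemma adj_weighted:
  assumes fin: "finite I" "finite J" and T: "T \<in> ops I J" and pos: "\<And>p. p \<in> I \<Longrightarrow> w p > 0"
  shows "adj I (weighted_form I w) J (weighted_form J v) T =
    mat_op J I (\<lambda>p q. cnj (T (ket p) q) * v q / w p)" (is "_ = ?T'")
    and "\<And>x y. x \<in> cvecs I \<Longrightarrow> y \<in> cvecs J \<Longrightarrow> weighted_form J v (T x) y =
      weighted_form I w x (adj I (weighted_form I w) J (weighted_form J v) T y)"
proof -
  have T': "weighted_form J v (T x) y = weighted_form I w x (?T' y)"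
    if x: "x \<in> cvecs I" and y: "y \<in> cvecs J" for x y
  proof -
    have "weighted_form J v (T x) y =
        (\<Sum>q\<in>J. \<Sum>p\<in>I. of_real (v q) * T (ket p) q * x p * cnj (y q))"
      unfolding weighted_form_def
      by (intro sum.cong refl)
        (simp add: ops_apply[OF fin(1) T x] sum_distrib_left sum_distrib_right mult.assoc)
    also have "\<dots> = (\<Sum>p\<in>I. \<Sum>q\<in>J. of_real (v q) * T (ket p) q * x p * cnj (y q))"
      by (rule sum.swap)
    also have "\<dots> = weighted_form I w x (?T' y)"
      unfolding weighted_form_def
    proof (intro sum.cong refl)
      fix p assume "p \<in> I"
      then have "complex_of_real (w p) \<noteq> 0" using pos[of p] by simp
      then show "(\<Sum>q\<in>J. of_real (v q) * T (ket p) q * x p * cnj (y q)) =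
        of_real (w p) * x p * cnj (?T' y p)"
        using \<open>p \<in> I\<close> y
        by (simp add: mat_op_apply sum_distrib_left mult_ac)
    qed
    finally show ?thesis .
  qed
  show adj: "adj I (weighted_form I w) J (weighted_form J v) T = ?T'"
    unfolding adj_def
  proof (rule the_equality)
    show "?T' \<in> ops J I \<and> (\<forall>x\<in>cvecs I. \<forall>y\<in>cvecs J.
      weighted_form J v (T x) y = weighted_form I w x (?T' y))"
      using T' mat_op_in_ops by blast
  next
    fix U assume U: "U \<in> ops J I \<and> (\<forall>x\<in>cvecs I. \<forall>y\<in>cvecs J.
      weighted_form J v (T x) y = weighted_form I w x (U y))"
    show "U = ?T'"
    proof (rule ops_eqI[OF fin(2)])
      fix p q assume pq: "p \<in> I" "q \<in> J"
      have "weighted_form I w (ket p) (U (ket q)) = weighted_form I w (ket p) (?T' (ket q))"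
        using U T'[of "ket p" "ket q"] pq by simp
      moreover have "weighted_form I w (ket p) y = of_real (w p) * cnj (y p)" for y
      proof -
        have "weighted_form I w (ket p) y = (\<Sum>p'\<in>I. if p' = p then w p * cnj (y p) else 0)"
          unfolding weighted_form_def by (intro sum.cong) (auto simp: ket_def)
        then show ?thesis using fin pq by simp
      qed
      ultimately show "U (ket q) p = ?T' (ket q) p" using pos[OF pq(1)] by simp
    qed (use U mat_op_in_ops in auto)
  qed
  show "weighted_form J v (T x) y =
      weighted_form I w x (adj I (weighted_form I w) J (weighted_form J v) T y)"
    if "x \<in> cvecs I" "y \<in> cvecs J" for x y
    using T'[OF that] adj by simp
qed


section \<open>The matrix algebra in coordinates\<close>

text \<open>The diagonal of the \<open>L\<^sup>2\<close> inner product; it depends on the block only.\<close>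

definition block_weight :: "nat list \<Rightarrow> midx \<Rightarrow> real" where
  "block_weight ns = (\<lambda>(i, j, k). real (ns ! i) / real (mdim ns))"

lemma midx_Sigma: "midx ns = (SIGMA i:{..<length ns}. {..<ns ! i} \<times> {..<ns ! i})"
  by (auto simp: midx_def)

lemma midx_iff: "(i, j, k) \<in> midx ns \<longleftrightarrow> i < length ns \<and> j < ns ! i \<and> k < ns ! i"
  by (simp add: midx_def)

lemma finite_midx [simp]: "finite (midx ns)"
  by (simp add: midx_Sigma)

lemma sum_midx:
  "(\<Sum>p\<in>midx ns. f p) = (\<Sum>i<length ns. \<Sum>j<ns ! i. \<Sum>k<ns ! i. f (i, j, k))"
proof -
  have "(\<Sum>i<length ns. \<Sum>x\<in>{..<ns ! i} \<times> {..<ns ! i}. f (i, x)) = (\<Sum>p\<in>midx ns. f p)"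
    unfolding midx_Sigma by (subst sum.Sigma) (auto simp: case_prod_unfold)
  then show ?thesis by (simp add: sum.cartesian_product case_prod_unfold)
qed

lemma mdim_eq_card: "mdim ns = card (midx ns)"
  by (simp add: mdim_def malg_def dim_cvecs)

lemma mdim_eq_sum: "mdim ns = (\<Sum>i<length ns. ns ! i * ns ! i)"
  by (simp add: mdim_eq_card midx_Sigma)

lemma mdim_pos: "p \<in> midx ns \<Longrightarrow> 0 < mdim ns"
  unfolding mdim_eq_card by (metis card_gt_0_iff empty_iff finite_midx)

lemma block_weight_pos: "p \<in> midx ns \<Longrightarrow> 0 < block_weight ns p"
  using mdim_pos[of p ns] by (auto simp: block_weight_def midx_iff split: prod.splits)

lemma l2_form_weighted: "l2_form ns = weighted_form (midx ns) (block_weight ns)"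
proof (intro ext)
  fix x y
  have "l2_form ns x y = (\<Sum>i<length ns. \<Sum>j<ns ! i. \<Sum>k<ns ! i.
      complex_of_real (block_weight ns (i, k, j)) * x (i, k, j) * cnj (y (i, k, j)))"
    unfolding l2_form_def psi_def mmult_def mstar_def block_weight_def
    by (simp add: sum_distrib_left mult_ac)
  also have "\<dots> = (\<Sum>i<length ns. \<Sum>j<ns ! i. \<Sum>k<ns ! i.
      complex_of_real (block_weight ns (i, j, k)) * x (i, j, k) * cnj (y (i, j, k)))"
    by (rule sum.cong[OF refl]) (rule sum.swap)
  finally show "l2_form ns x y = weighted_form (midx ns) (block_weight ns) x y"
    by (simp add: weighted_form_def sum_midx)
qed

lemma mone_in_malg [simp]: "mone ns \<in> malg ns"
  by (auto simp: mone_def malg_def cvecs_def)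

lemma psi_weighted: "psi ns x = (\<Sum>p\<in>midx ns. block_weight ns p * mone ns p * x p)"
proof -
  have "(\<Sum>p\<in>midx ns. block_weight ns p * mone ns p * x p) =
    (\<Sum>i<length ns. \<Sum>j<ns ! i. \<Sum>k<ns ! i. if k = j then block_weight ns (i, j, j) * x (i, j, j) else 0)"
    unfolding sum_midx by (intro sum.cong refl) (auto simp: mone_def midx_iff)
  also have "\<dots> = (\<Sum>i<length ns. \<Sum>j<ns ! i. block_weight ns (i, j, j) * x (i, j, j))"
    by (intro sum.cong refl) simp
  also have "\<dots> = psi ns x"
    by (simp add: psi_def block_weight_def sum_distrib_left)
  finally show ?thesis by simp
qed

lemma psi_add: "psi ns (x + y) = psi ns x + psi ns y"
  by (simp add: psi_weighted algebra_simps sum.distrib)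

lemma psi_scale: "psi ns (cscale c x) = c * psi ns x"
  by (simp add: psi_weighted cscale_def sum_distrib_left mult_ac)

lemma psi_mone:
  assumes "0 < mdim ns"
  shows "psi ns (mone ns) = 1"
proof -
  have "(\<Sum>j<ns ! i. mone ns (i, j, j)) = of_nat (ns ! i)" if "i < length ns" for i
    using that by (simp add: mone_def midx_iff)
  then have "psi ns (mone ns) = (1 / of_nat (mdim ns)) * of_nat (mdim ns)"
    by (simp add: psi_def mdim_eq_sum)
  then show ?thesis using assms by simp
qed

lemma psi_ket: "p \<in> midx ns \<Longrightarrow> psi ns (ket p) = block_weight ns p * mone ns p"
  unfolding psi_weighted ket_def by (simp add: if_distrib cong: if_cong)

lemma mmult_mone:
  assumes "x \<in> malg ns"
  shows "mmult ns x (mone ns) = x"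
proof (rule ext, clarify)
  fix i j k
  have "mmult ns x (mone ns) (i, j, k) = (\<Sum>l<ns ! i. if l = k then x (i, j, k) else 0)"
    unfolding mmult_def prod.case using assms
    by (intro sum.cong) (auto simp: mone_def midx_iff malg_def cvecs_def)
  also have "\<dots> = x (i, j, k)"
    using assms by (auto simp: malg_def cvecs_def midx_iff)
  finally show "mmult ns x (mone ns) (i, j, k) = x (i, j, k)" .
qed

lemma mmult_scale: "mmult ns x (cscale c y) = cscale c (mmult ns x y)"
  by (auto simp: mmult_def cscale_def sum_distrib_left mult_ac)

lemma mmult_assoc: "mmult ns (mmult ns x y) z = mmult ns x (mmult ns y z)"
proof (rule ext, clarify)
  fix i j k
  have "mmult ns (mmult ns x y) z (i, j, k) =
      (\<Sum>l<ns ! i. \<Sum>m<ns ! i. x (i, j, m) * y (i, m, l) * z (i, l, k))"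
    by (simp add: mmult_def sum_distrib_right)
  also have "\<dots> = (\<Sum>m<ns ! i. \<Sum>l<ns ! i. x (i, j, m) * y (i, m, l) * z (i, l, k))"
    by (rule sum.swap)
  also have "\<dots> = mmult ns x (mmult ns y z) (i, j, k)"
    by (simp add: mmult_def sum_distrib_left mult.assoc)
  finally show "mmult ns (mmult ns x y) z (i, j, k) = mmult ns x (mmult ns y z) (i, j, k)" .
qed

lemma mmult_in_malg: "x \<in> malg ns \<Longrightarrow> y \<in> malg ns \<Longrightarrow> mmult ns x y \<in> malg ns"
  by (auto simp: mmult_def malg_def cvecs_def midx_iff intro!: sum.neutral)

lemma mmult_ket_right:
  assumes "(i, b, a) \<in> midx ns"
  shows "mmult ns x (ket (i, b, a)) (i', j, l) = (if i' = i \<and> l = a then x (i, j, b) else 0)"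
proof -
  have "mmult ns x (ket (i, b, a)) (i', j, l) =
      (\<Sum>m<ns ! i'. if m = b then if i' = i \<and> l = a then x (i, j, b) else 0 else 0)"
    unfolding mmult_def prod.case by (intro sum.cong) (auto simp: ket_def)
  also have "\<dots> = (if i' = i \<and> l = a then x (i, j, b) else 0)"
    using assms by (auto simp: midx_iff)
  finally show ?thesis .
qed

lemma mmult_ket_left:
  assumes "(i, a, b) \<in> midx ns"
  shows "mmult ns (ket (i, a, b)) x (i', j, l) = (if i' = i \<and> j = a then x (i, b, l) else 0)"
proof -
  have "mmult ns (ket (i, a, b)) x (i', j, l) =
      (\<Sum>m<ns ! i'. if m = b then if i' = i \<and> j = a then x (i, b, l) else 0 else 0)"
    unfolding mmult_def prod.case by (intro sum.cong) (auto simp: ket_def)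
  also have "\<dots> = (if i' = i \<and> j = a then x (i, b, l) else 0)"
    using assms by (auto simp: midx_iff)
  finally show ?thesis .
qed

lemma lmul_in_bl2:
  assumes "x \<in> malg ns"
  shows "lmul ns x \<in> bl2 ns"
  using mmult_in_malg[OF assms] unfolding lmul_def bl2_def ops_def malg_def
  by (auto simp: mmult_def cscale_def cvecs_add cvecs_scale[unfolded cscale_def] algebra_simps
      sum.distrib sum_distrib_left fun_eq_iff)

text \<open>The right multiplications, which form the commutant of the left multiplications.\<close>

definition rmul :: "nat list \<Rightarrow> midx cvec \<Rightarrow> (midx, midx) op" where
  "rmul ns x = (\<lambda>y. if y \<in> malg ns then mmult ns y x else 0)"

lemma rmul_in_mcomm:
  assumes "x \<in> malg ns"
  shows "rmul ns x \<in> mcomm ns"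
proof -
  have "rmul ns x \<in> bl2 ns"
    using mmult_in_malg[OF _ assms] unfolding rmul_def bl2_def ops_def malg_def
    by (auto simp: mmult_def cscale_def cvecs_add cvecs_scale[unfolded cscale_def] algebra_simps
        sum.distrib sum_distrib_left fun_eq_iff)
  moreover have "rmul ns x \<circ> lmul ns y = lmul ns y \<circ> rmul ns x" if "y \<in> malg ns" for y
  proof -
    have "mmult ns 0 x = 0" "mmult ns y 0 = 0" "0 \<in> malg ns"
      by (auto simp: mmult_def fun_eq_iff malg_def)
    then show ?thesis
      using mmult_in_malg assms that by (auto simp: rmul_def lmul_def mmult_assoc fun_eq_iff)
  qed
  ultimately show ?thesis by (simp add: mcomm_def)
qed


section \<open>The adjacency map and the space of the complete graph\<close>

lemma sum_ket:
  fixes g :: "'a \<Rightarrow> complex"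
  assumes "finite I" "a \<in> I"
  shows "(\<Sum>q\<in>I. ket q a * g q) = g a"
proof -
  have "(\<Sum>q\<in>I. ket q a * g q) = (\<Sum>q\<in>I. if a = q then g q else 0)"
    by (intro sum.cong) (auto simp: ket_def)
  then show ?thesis using assms by simp
qed

text \<open>The structure constants of the multiplication are 0 or 1: the pairs of matrix units with
  product having a nonzero \<open>(i, j, l)\<close> entry are exactly \<open>(i, j, m)\<close>, \<open>(i, m, l)\<close>.\<close>

lemma sum_mmult_kets:
  assumes "(i, j, l) \<in> midx ns"
  shows "(\<Sum>(q, r)\<in>midx ns \<times> midx ns. mmult ns (ket q) (ket r) (i, j, l) * f q r) =
    (\<Sum>m<ns ! i. f (i, j, m) (i, m, l))"
proof -
  have "(\<Sum>(q, r)\<in>midx ns \<times> midx ns. mmult ns (ket q) (ket r) (i, j, l) * f q r) =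
      (\<Sum>q\<in>midx ns. \<Sum>r\<in>midx ns. \<Sum>m<ns ! i. ket q (i, j, m) * (ket r (i, m, l) * f q r))"
    unfolding sum.cartesian_product[symmetric]
    by (simp add: mmult_def sum_distrib_right mult.assoc)
  also have "\<dots> = (\<Sum>q\<in>midx ns. \<Sum>m<ns ! i. \<Sum>r\<in>midx ns. ket q (i, j, m) * (ket r (i, m, l) * f q r))"
    by (intro sum.cong refl sum.swap)
  also have "\<dots> = (\<Sum>m<ns ! i. \<Sum>q\<in>midx ns. \<Sum>r\<in>midx ns. ket q (i, j, m) * (ket r (i, m, l) * f q r))"
    by (rule sum.swap)
  also have "\<dots> = (\<Sum>m<ns ! i. f (i, j, m) (i, m, l))"
  proof (intro sum.cong refl)
    fix m assume "m \<in> {..<ns ! i}"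
    then have "(i, j, m) \<in> midx ns" "(i, m, l) \<in> midx ns" using assms by (auto simp: midx_iff)
    then show "(\<Sum>q\<in>midx ns. \<Sum>r\<in>midx ns. ket q (i, j, m) * (ket r (i, m, l) * f q r)) =
        f (i, j, m) (i, m, l)"
      by (simp add: sum_distrib_left[symmetric] sum_ket)
  qed
  finally show ?thesis .
qed

lemma mult_op_eq_mat_op:
  "mult_op ns = mat_op (midx ns \<times> midx ns) (midx ns) (\<lambda>p (q, r). mmult ns (ket q) (ket r) p)"
proof -
  have "(\<Sum>q\<in>midx ns. \<Sum>r\<in>midx ns. cscale (z (q, r)) (mmult ns (ket q) (ket r))) p =
      (if p \<in> midx ns
       then \<Sum>(q, r)\<in>midx ns \<times> midx ns. mmult ns (ket q) (ket r) p * z (q, r) else 0)" for z p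
  proof -
    have "mmult ns (ket q) (ket r) p = 0" if "q \<in> midx ns" "r \<in> midx ns" "p \<notin> midx ns" for q r
    proof -
      have "mmult ns (ket q) (ket r) \<in> cvecs (midx ns)"
        using mmult_in_malg[of "ket q" ns "ket r"] that by (simp add: malg_def)
      then show ?thesis using that(3) unfolding cvecs_def by blast
    qed
    then show ?thesis
      by (auto simp: sum_fun_apply cscale_def mult.commute sum.cartesian_product case_prod_unfold
          intro!: sum.neutral)
  qed
  then show ?thesis
    unfolding mult_op_def mat_op_def by (auto simp: fun_eq_iff case_prod_unfold)
qed

lemma mult_op_in_ops: "mult_op ns \<in> ops (midx ns \<times> midx ns) (midx ns)"
  by (simp add: mult_op_eq_mat_op mat_op_in_ops)

lemma comult_op_eq_mat_op:
  "comult_op ns = mat_op (midx ns) (midx ns \<times> midx ns)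
     (\<lambda>(q, r) p. mmult ns (ket q) (ket r) p * block_weight ns p /
        (block_weight ns q * block_weight ns r))"
proof -
  \<comment> \<open>The structure constants are real, so the adjoint only rescales by weights.\<close>
  have cnj: "cnj (mmult ns (ket q) (ket r) p) = mmult ns (ket q) (ket r) p" for q r p
    by (auto simp: mmult_def ket_def split: prod.splits intro!: sum.cong)
  show ?thesis
    unfolding comult_op_def l2_form_weighted ten_form_weighted[OF finite_midx finite_midx]
    by (subst adj_weighted(1)[OF _ _ mult_op_in_ops])
      (auto simp: block_weight_pos mult_op_eq_mat_op cnj intro!: mat_op_cong)
qed

lemma adjacency_map_in_bl2:
  assumes "A \<in> bl2 ns" "X \<in> bl2 ns"
  shows "adjacency_map ns A X \<in> bl2 ns"
proof -
  have "comult_op ns \<in> ops (midx ns) (midx ns \<times> midx ns)"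
    by (simp add: comult_op_eq_mat_op mat_op_in_ops)
  moreover have "ten_op (midx ns) (midx ns) A X \<in> ops (midx ns \<times> midx ns) (midx ns \<times> midx ns)"
    using assms unfolding bl2_def by (intro ten_op_in_ops) auto
  ultimately have "mult_op ns \<circ> ten_op (midx ns) (midx ns) A X \<circ> comult_op ns \<in> bl2 ns"
    unfolding bl2_def by (intro ops_comp[OF _ ops_comp[OF _ mult_op_in_ops]])
  then show ?thesis
    unfolding adjacency_map_def using cop.subspace_scale[OF subspace_ops] by (simp add: bl2_def)
qed

lemma delta_sq: "(complex_of_real (delta ns))\<^sup>2 = of_nat (mdim ns)"
  by (simp add: delta_def flip: of_real_power)

text \<open>The factor combines \<open>\<delta>\<^sup>-\<^sup>2 = 1 / d\<close> with the weights of the comultiplication, which on the block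
  \<open>i'\<close> contribute \<open>d / n\<^sub>i\<^sub>'\<close>.\<close>

lemma adjacency_map_ket:
  assumes A: "A \<in> bl2 ns" and X: "X \<in> bl2 ns"
    and p: "(i, j, l) \<in> midx ns" and p': "(i', j', l') \<in> midx ns"
  shows "adjacency_map ns A X (ket (i', j', l')) (i, j, l) =
    (\<Sum>m<ns ! i. \<Sum>m'<ns ! i'. A (ket (i', j', m')) (i, j, m) * X (ket (i', m', l')) (i, m, l)) /
      of_nat (ns ! i')"
proof -
  let ?I = "midx ns" and ?M = "\<lambda>p (q, r). mmult ns (ket q) (ket r) p"
  let ?AX = "ten_op ?I ?I A X" and ?w = "\<lambda>p. complex_of_real (block_weight ns p)"
  note AX = ten_op_in_ops[OF finite_midx finite_midx A[unfolded bl2_def] X[unfolded bl2_def]]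
  have comult: "comult_op ns \<in> ops ?I (?I \<times> ?I)"
    by (simp add: comult_op_eq_mat_op mat_op_in_ops)
  have inner: "(?AX \<circ> comult_op ns) (ket (i', j', l')) (q, r) =
      (\<Sum>m'<ns ! i'. A (ket (i', j', m')) q * X (ket (i', m', l')) r *
         (of_nat (mdim ns) / of_nat (ns ! i')))"
    if qr: "q \<in> ?I" "r \<in> ?I" for q r
  proof -
    have "(?AX \<circ> comult_op ns) (ket (i', j', l')) (q, r) =
        (\<Sum>z\<in>?I \<times> ?I. ?AX (ket z) (q, r) * comult_op ns (ket (i', j', l')) z)"
      by (rule comp_ket[OF _ comult AX]) (use p' qr in auto)
    also have "\<dots> = (\<Sum>(q', r')\<in>?I \<times> ?I. mmult ns (ket q') (ket r') (i', j', l') *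
        (A (ket q') q * X (ket r') r * (?w (i', j', l') / (?w q' * ?w r'))))"
      using A X p' qr unfolding bl2_def
      by (intro sum.cong) (auto simp: ten_op_ket comult_op_eq_mat_op)
    also have "\<dots> = (\<Sum>m'<ns ! i'. A (ket (i', j', m')) q * X (ket (i', m', l')) r *
        (?w (i', j', l') / (?w (i', j', m') * ?w (i', m', l'))))"
      by (rule sum_mmult_kets[OF p'])
    finally show ?thesis
      using mdim_pos[OF p'] by (simp add: block_weight_def)
  qed
  have "(mult_op ns \<circ> (?AX \<circ> comult_op ns)) (ket (i', j', l')) (i, j, l) =
      (\<Sum>z\<in>?I \<times> ?I. mult_op ns (ket z) (i, j, l) * (?AX \<circ> comult_op ns) (ket (i', j', l')) z)"
    by (rule comp_ket[OF _ ops_comp[OF comult AX] mult_op_in_ops]) (use p p' in auto)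
  also have "\<dots> = (\<Sum>(q, r)\<in>?I \<times> ?I. mmult ns (ket q) (ket r) (i, j, l) *
      (\<Sum>m'<ns ! i'. A (ket (i', j', m')) q * X (ket (i', m', l')) r *
         (of_nat (mdim ns) / of_nat (ns ! i'))))"
    using p by (intro sum.cong) (auto simp: inner mult_op_eq_mat_op simp del: comp_apply)
  also have "\<dots> = (\<Sum>m<ns ! i. \<Sum>m'<ns ! i'. A (ket (i', j', m')) (i, j, m) *
      X (ket (i', m', l')) (i, m, l) * (of_nat (mdim ns) / of_nat (ns ! i')))"
    by (rule sum_mmult_kets[OF p])
  finally show ?thesis
    using mdim_pos[OF p]
    by (simp add: adjacency_map_def oscale_def cscale_def delta_sq sum_divide_distrib)
qed

lemma complete_adjacency_in_bl2: "complete_adjacency ns \<in> bl2 ns"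
  unfolding bl2_def ops_def malg_def[symmetric]
proof (intro CollectI conjI ballI allI impI)
  have sub: "cvec.subspace (malg ns)" by (simp add: malg_def subspace_cvecs)
  fix x y c assume x: "x \<in> malg ns"
  show "complete_adjacency ns x \<in> malg ns"
    using x cvec.subspace_diff[OF sub] cvec.subspace_scale[OF sub]
    by (simp add: complete_adjacency_def)
  show "complete_adjacency ns (cscale c x) = cscale c (complete_adjacency ns x)"
    using x cvec.subspace_scale[OF sub x]
    by (simp add: complete_adjacency_def psi_scale cvec.scale_right_diff_distrib mult_ac)
  show "complete_adjacency ns (x + y) = complete_adjacency ns x + complete_adjacency ns y"
    if "y \<in> malg ns"
    using cvec.subspace_add[OF sub x that] x that
    by (simp only: complete_adjacency_def if_True psi_add)
      (simp add: fun_eq_iff cscale_def algebra_simps)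
qed (simp add: complete_adjacency_def)

lemma complete_adjacency_ket:
  assumes "q \<in> midx ns"
  shows "complete_adjacency ns (ket q) p =
    of_nat (mdim ns) * block_weight ns q * mone ns q * mone ns p - ket q p"
  using assms by (simp add: complete_adjacency_def malg_def psi_ket delta_sq cscale_def mult.assoc)

text \<open>Block \<open>i\<close> of \<open>L\<^sup>2\<close> is a tensor square \<open>\<complex>\<^sup>n \<otimes> \<complex>\<^sup>n\<close> with left multiplications acting on the
  first factor. The slice trace is the \<open>(l, l')\<close> entry of the partial trace over that factor.\<close>

definition slice_trace :: "nat list \<Rightarrow> midx \<Rightarrow> (midx, midx) op \<Rightarrow> complex" where
  "slice_trace ns = (\<lambda>(i, l, l') X. \<Sum>m<ns ! i. X (ket (i, m, l')) (i, m, l))"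

text \<open>The term \<open>\<delta>\<^sup>2 \<psi>(\<cdot>) 1\<close> of the adjacency matrix reproduces \<open>X\<close>, and the term \<open>- I\<close> subtracts the
  projection of \<open>X\<close> to the commutant.\<close>

lemma complete_adjacency_map_ket:
  assumes X: "X \<in> bl2 ns"
    and p: "(i, j, l) \<in> midx ns" and p': "(i', j', l') \<in> midx ns"
  shows "adjacency_map ns (complete_adjacency ns) X (ket (i', j', l')) (i, j, l) =
    X (ket (i', j', l')) (i, j, l) -
      (if i = i' \<and> j = j' then slice_trace ns (i, l, l') X / of_nat (ns ! i) else 0)"
proof -
  define c :: complex where "c = (if i = i' \<and> j = j' then 1 else 0)"
  have n: "of_nat (ns ! i') \<noteq> (0::complex)" using p' by (auto simp: midx_iff)
  have entry: "complete_adjacency ns (ket (i', j', m')) (i, j, m) =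
      (if m' = j' then if m = j then of_nat (ns ! i') else 0 else 0) - (if m' = m then c else 0)"
    if "m < ns ! i" "m' < ns ! i'" for m m'
    using that p p' mdim_pos[OF p]
    by (subst complete_adjacency_ket)
      (auto simp: midx_iff mone_def block_weight_def ket_def c_def)
  have "(\<Sum>m<ns ! i. \<Sum>m'<ns ! i'. complete_adjacency ns (ket (i', j', m')) (i, j, m) *
        X (ket (i', m', l')) (i, m, l)) =
      (\<Sum>m<ns ! i. \<Sum>m'<ns ! i'.
        (if m' = j' then if m = j then of_nat (ns ! i') * X (ket (i', m', l')) (i, m, l) else 0 else 0) -
        (if m' = m then c * X (ket (i', m', l')) (i, m, l) else 0))"
    by (intro sum.cong refl) (auto simp: entry algebra_simps)
  also have "\<dots> = (\<Sum>m<ns ! i. if m = j then of_nat (ns ! i') * X (ket (i', j', l')) (i, m, l) else 0) -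
      (\<Sum>m<ns ! i. if m < ns ! i' then c * X (ket (i', m, l')) (i, m, l) else 0)"
    using p' by (simp add: sum_subtractf midx_iff)
  also have "(\<Sum>m<ns ! i. if m < ns ! i' then c * X (ket (i', m, l')) (i, m, l) else 0) =
      c * slice_trace ns (i, l, l') X"
    unfolding slice_trace_def prod.case sum_distrib_left
    by (intro sum.cong refl) (auto simp: c_def)
  finally show ?thesis
    using n p by (simp add: adjacency_map_ket[OF complete_adjacency_in_bl2 X p p'] diff_divide_distrib
        midx_iff) (simp add: c_def)
qed

lemma slice_trace_complete_adjacency:
  assumes "p \<in> midx ns"
  shows "slice_trace ns p (complete_adjacency ns) = 0"
proof -
  obtain i l l' where p: "p = (i, l, l')" by (cases p)
  have "slice_trace ns p (complete_adjacency ns) =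
      (\<Sum>m<ns ! i. (if m = l' then if l = l' then of_nat (ns ! i) else 0 else 0) -
        (if l = l' then 1 else 0))"
    unfolding slice_trace_def p prod.case
  proof (rule sum.cong[OF refl])
    fix m assume "m \<in> {..<ns ! i}"
    then have mem: "(i, m, l) \<in> midx ns" "(i, m, l') \<in> midx ns"
      using assms by (simp_all add: p midx_iff)
    show "complete_adjacency ns (ket (i, m, l')) (i, m, l) =
        (if m = l' then if l = l' then of_nat (ns ! i) else 0 else 0) - (if l = l' then 1 else 0)"
      unfolding complete_adjacency_ket[OF mem(2)] using mem mdim_pos[OF mem(1)]
      by (auto simp: block_weight_def mone_def ket_def)
  qed
  also have "\<dots> = 0"
    using assms by (auto simp: sum_subtractf p midx_iff)
  finally show ?thesis .
qed

text \<open>This identifies orthogonality to the commutant with the vanishing of all slice traces.\<close>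

lemma trace_form_rmul_ket:
  assumes X: "X \<in> bl2 ns" and p: "(i, a, b) \<in> midx ns"
  shows "trace_form ns X (rmul ns (ket (i, b, a))) = slice_trace ns (i, a, b) X"
proof -
  let ?T = "rmul ns (ket (i, b, a))" and ?w = "block_weight ns"
  have p': "(i, b, a) \<in> midx ns" using p by (simp add: midx_iff)
  then have T: "?T \<in> ops (midx ns) (midx ns)"
    using rmul_in_mcomm[of "ket (i, b, a)" ns] by (simp add: malg_def mcomm_def bl2_def)
  have adj: "l2_adj ns ?T = mat_op (midx ns) (midx ns) (\<lambda>p q. cnj (?T (ket p) q) * ?w q / ?w p)"
    unfolding l2_adj_def l2_form_weighted
    by (rule adj_weighted(1)[OF _ _ T]) (auto simp: block_weight_pos)
  have entry: "cnj (?T (ket q) r) * ?w r / ?w q * X (ket q) r =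
      (case r of (i', j, l) \<Rightarrow> if i' = i \<and> l = a then ket q (i, j, b) * X (ket q) r else 0)"
    if "q \<in> midx ns" "r \<in> midx ns" for q r
  proof -
    obtain i' j l where r: "r = (i', j, l)" by (cases r)
    have "?T (ket q) r = (if i' = i \<and> l = a then ket q (i, j, b) else 0)"
      using that by (simp add: rmul_def malg_def mmult_ket_right[OF p'] r)
    moreover have "cnj (ket q (i, j, b)) = ket q (i, j, b)" by (simp add: ket_def)
    moreover have "?w q = ?w r" if "i' = i" "ket q (i, j, b) \<noteq> 0"
      using that by (auto simp: ket_def block_weight_def r split: if_splits)
    moreover have "?w q \<noteq> 0" using block_weight_pos[OF that(1)] by simp
    ultimately show ?thesis
      by (cases "i' = i \<and> l = a \<and> ket q (i, j, b) \<noteq> 0") (auto simp: r)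
  qed
  have "trace_form ns X ?T =
      (\<Sum>q\<in>midx ns. \<Sum>r\<in>midx ns. cnj (?T (ket q) r) * ?w r / ?w q * X (ket q) r)"
    unfolding trace_form_def op_trace_def
  proof (rule sum.cong[OF refl])
    fix q assume q: "q \<in> midx ns"
    have "(l2_adj ns ?T \<circ> X) (ket q) q = (\<Sum>r\<in>midx ns. l2_adj ns ?T (ket r) q * X (ket q) r)"
      by (rule comp_ket[OF finite_midx X[unfolded bl2_def] _ q q]) (simp add: adj mat_op_in_ops)
    then show "(l2_adj ns ?T \<circ> X) (ket q) q =
        (\<Sum>r\<in>midx ns. cnj (?T (ket q) r) * ?w r / ?w q * X (ket q) r)"
      using q by (simp add: adj)
  qed
  also have "\<dots> = (\<Sum>q\<in>midx ns. \<Sum>r\<in>midx ns.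
      case r of (i', j, l) \<Rightarrow> if i' = i \<and> l = a then ket q (i, j, b) * X (ket q) r else 0)"
    by (intro sum.cong refl entry)
  also have "\<dots> = (\<Sum>r\<in>midx ns. \<Sum>q\<in>midx ns.
      case r of (i', j, l) \<Rightarrow> if i' = i \<and> l = a then ket q (i, j, b) * X (ket q) r else 0)"
    by (rule sum.swap)
  also have "\<dots> = (\<Sum>r\<in>midx ns.
      case r of (i', j, l) \<Rightarrow> if l = a then if i' = i then X (ket (i, j, b)) (i, j, a) else 0 else 0)"
  proof (rule sum.cong[OF refl], clarify)
    fix i' j l assume r: "(i', j, l) \<in> midx ns"
    show "(\<Sum>q\<in>midx ns. if i' = i \<and> l = a then ket q (i, j, b) * X (ket q) (i', j, l) else 0) =
        (if l = a then if i' = i then X (ket (i, j, b)) (i, j, a) else 0 else 0)"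
      using r p by (auto simp: sum_ket midx_iff)
  qed
  also have "\<dots> = (\<Sum>i'<length ns. if i' = i then \<Sum>j<ns ! i. X (ket (i, j, b)) (i, j, a) else 0)"
    unfolding sum_midx prod.case
  proof (rule sum.cong[OF refl])
    fix i' show "(\<Sum>j<ns ! i'. \<Sum>l<ns ! i'.
          if l = a then if i' = i then X (ket (i, j, b)) (i, j, a) else 0 else 0) =
        (if i' = i then \<Sum>j<ns ! i. X (ket (i, j, b)) (i, j, a) else 0)"
      using p by (cases "i' = i") (auto simp: midx_iff intro!: sum.neutral)
  qed
  also have "\<dots> = slice_trace ns (i, a, b) X"
    using p by (simp add: slice_trace_def midx_iff)
  finally show ?thesis .
qed

lemma complete_graph_space:
  assumes graph: "quantum_graph ns (complete_adjacency ns) S" and irr: "irreflexive_space ns S"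
  shows "S = {X \<in> bl2 ns. \<forall>p\<in>midx ns. slice_trace ns p X = 0}"
proof (intro equalityI subsetI CollectI conjI ballI)
  fix X assume "X \<in> S"
  then show X: "X \<in> bl2 ns"
    using graph by (auto simp: quantum_graph_def quantum_graph_space_def)
  fix p assume p: "p \<in> midx ns"
  obtain i a b where [simp]: "p = (i, a, b)" by (cases p)
  have "ket (i, b, a) \<in> malg ns" using p by (simp add: malg_def midx_iff)
  then have "trace_form ns X (rmul ns (ket (i, b, a))) = 0"
    using irr \<open>X \<in> S\<close> rmul_in_mcomm unfolding irreflexive_space_def by blast
  then show "slice_trace ns p X = 0" using trace_form_rmul_ket[OF X] p by simp
next
  fix X assume X: "X \<in> {X \<in> bl2 ns. \<forall>p\<in>midx ns. slice_trace ns p X = 0}"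
  have "adjacency_map ns (complete_adjacency ns) X = X"
  proof (rule ops_eqI[OF finite_midx])
    fix p q assume pq: "p \<in> midx ns" "q \<in> midx ns"
    obtain i j l where [simp]: "p = (i, j, l)" by (cases p)
    obtain i' j' l' where [simp]: "q = (i', j', l')" by (cases q)
    have "slice_trace ns (i, l, l') X = 0" if "i = i'"
      using X pq that by (auto simp: midx_iff)
    then show "adjacency_map ns (complete_adjacency ns) X (ket q) p = X (ket q) p"
      using X pq by (auto simp: complete_adjacency_map_ket)
  qed (use X adjacency_map_in_bl2[OF complete_adjacency_in_bl2] in \<open>auto simp: bl2_def\<close>)
  then show "X \<in> S"
    using graph X unfolding quantum_graph_def orth_projection_onto_def by force
qed

text \<open>The slice traces are independent: the matrix units that belong to the index 0 of the first
  tensor factor of each block form a dual system for them.\<close>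

lemma dim_complete_graph_space:
  "cop.dim {X \<in> bl2 ns. \<forall>p\<in>midx ns. slice_trace ns p X = 0} = mdim ns * mdim ns - mdim ns"
proof -
  let ?I = "midx ns"
  let ?b = "\<lambda>(i, l, l'). mat_op ?I ?I (\<lambda>p q. if p = (i, 0, l) \<and> q = (i, 0, l') then 1 else 0)"
  obtain F where F: "finite F" "bl2 ns \<subseteq> cop.span F"
    using dim_ops(2)[OF finite_midx finite_midx] unfolding bl2_def by blast
  have dual: "slice_trace ns k (?b k') = (if k = k' then 1 else 0)" if "k \<in> ?I" "k' \<in> ?I" for k k'
  proof -
    obtain i l l' where k: "k = (i, l, l')" by (cases k)
    obtain i1 l1 l1' where k': "k' = (i1, l1, l1')" by (cases k')
    have "slice_trace ns k (?b k') = (\<Sum>m<ns ! i. if m = 0 then if k = k' then 1 else 0 else 0)"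
      unfolding slice_trace_def k k' prod.case
      by (intro sum.cong refl) (use that in \<open>auto simp: k k' midx_iff\<close>)
    then show ?thesis using that by (auto simp: k midx_iff)
  qed
  have "cop.dim (bl2 ns) = cop.dim {X \<in> bl2 ns. \<forall>p\<in>midx ns. slice_trace ns p X = 0} + card ?I"
  proof (rule cop.dim_common_kernel[where b = ?b, OF _ _ F])
    show "cop.subspace (bl2 ns)" by (simp add: bl2_def subspace_ops)
    show "?b k \<in> bl2 ns" for k by (simp add: bl2_def mat_op_in_ops split: prod.split)
    show "slice_trace ns k (?b k') = (if k = k' then 1 else 0)"
      if "k \<in> ?I" "k' \<in> ?I" for k k' using that by (rule dual)
  qed (auto simp: slice_trace_def oscale_def cscale_def sum.distrib sum_distrib_left
      split: prod.split)
  then show ?thesis using dim_ops(1)[OF finite_midx finite_midx, of ns ns]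
    by (simp add: bl2_def mdim_eq_card)
qed


section \<open>The spectra\<close>

text \<open>Applying \<open>\<psi>\<close> to the eigenvalue equation \<open>T x = r x\<close> gives \<open>(r - a - b) \<psi>(x) = 0\<close>. If
  \<open>\<psi>(x) = 0\<close>, then \<open>T x = a x\<close>; otherwise \<open>r = a + b\<close> and \<open>x\<close> is a multiple of the unit.\<close>

lemma spectrum_rank_one_perturbation:
  assumes T: "\<And>x. x \<in> malg ns \<Longrightarrow>
      T x = cscale (of_real a) x + cscale (of_real b * psi ns x) (mone ns)"
    and b: "b \<noteq> 0" and dim: "2 \<le> mdim ns"
  shows "eigvals ns T = {a, a + b}"
    and "eig_mult ns T a = mdim ns - 1" and "eig_mult ns T (a + b) = 1"
proof -
  let ?K = "{x \<in> malg ns. psi ns x = 0}"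
  have psi1: "psi ns (mone ns) = 1" using dim by (intro psi_mone) simp
  have psi0: "psi ns 0 = 0" by (simp add: psi_weighted)
  then have one: "mone ns \<noteq> 0" using psi1 by force
  have eig: "(x \<in> eigenspace ns T r) = (x \<in> malg ns \<and>
      cscale (of_real r - of_real a) x = cscale (of_real b * psi ns x) (mone ns))" for x r
    by (auto simp: eigenspace_def T cvec.scale_left_diff_distrib algebra_simps)
  have psi_eig: "of_real (r - a - b) * psi ns x = 0" if "x \<in> eigenspace ns T r" for x r
  proof -
    have "psi ns (cscale (of_real r - of_real a) x) = psi ns (cscale (of_real b * psi ns x) (mone ns))"
      using that unfolding eig by metis
    then show ?thesis unfolding psi_scale psi1 by (simp add: algebra_simps)
  qed
  have E1: "eigenspace ns T a = ?K"
    using b one by (auto simp: eig)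
  have E2: "eigenspace ns T (a + b) = cvec.span {mone ns}"
  proof (intro equalityI subsetI)
    fix x assume "x \<in> eigenspace ns T (a + b)"
    then have "cscale (of_real b) x = cscale (of_real b) (cscale (psi ns x) (mone ns))"
      by (simp add: eig)
    then have "x = cscale (psi ns x) (mone ns)" using b by (simp only: cvec.scale_cancel_left) simp
    then show "x \<in> cvec.span {mone ns}" by (metis cvec.span_base cvec.span_scale singletonI)
  next
    fix x assume "x \<in> cvec.span {mone ns}"
    then obtain c where "x = cscale c (mone ns)" by (auto simp: cvec.span_singleton)
    then show "x \<in> eigenspace ns T (a + b)"
      using mone_in_malg[of ns] by (simp add: eig psi_scale psi1 malg_def cvecs_scale)
  qed
  show m2: "eig_mult ns T (a + b) = 1"
    unfolding eig_mult_def E2 using one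
    by (simp add: cvec.dim_eq_card_independent cvec.independent_insert)
  have "cvec.dim (malg ns) = cvec.dim {x \<in> malg ns. \<forall>k\<in>{()}. psi ns x = 0} + card {()}"
    by (rule cvec.dim_common_kernel[where b = "\<lambda>_. mone ns" and F = "ket ` midx ns", OF _ _ finite_imageI[OF finite_midx]])
      (use psi1 dim_cvecs(2)[OF finite_midx] in
        \<open>auto simp: malg_def[symmetric] psi_add psi_scale subspace_cvecs[of "midx ns", folded malg_def]\<close>)
  then show m1: "eig_mult ns T a = mdim ns - 1"
    unfolding eig_mult_def E1 mdim_def by simp
  have "\<exists>x\<in>?K. x \<noteq> 0"
  proof (rule ccontr)
    assume "\<not> (\<exists>x\<in>?K. x \<noteq> 0)"
    then have "?K \<subseteq> {0}" by blast
    then have "cvec.dim ?K = 0"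
      using cvec.dim_le_card[of ?K "{}"] by simp
    then show False using m1 dim unfolding eig_mult_def E1 by simp
  qed
  then have "a \<in> eigvals ns T" by (simp add: eigvals_def E1)
  moreover have "a + b \<in> eigvals ns T"
  proof -
    have "mone ns \<in> eigenspace ns T (a + b)" by (simp add: E2 cvec.span_base)
    then show ?thesis using one unfolding eigvals_def by blast
  qed
  moreover have "r \<in> {a, a + b}" if r: "r \<in> eigvals ns T" for r
  proof (rule ccontr)
    assume "r \<notin> {a, a + b}"
    obtain x where x: "x \<in> eigenspace ns T r" "x \<noteq> 0" using r by (auto simp: eigvals_def)
    have "psi ns x = 0"
      using psi_eig[OF x(1)] \<open>r \<notin> {a, a + b}\<close> by (auto simp del: of_real_diff)
    then have "cscale (of_real r - of_real a) x = 0" using x(1) by (simp add: eig)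
    then show False using x(2) \<open>r \<notin> {a, a + b}\<close> by simp
  qed
  ultimately show "eigvals ns T = {a, a + b}" by blast
qed

lemma complete_adjacency_apply:
  "x \<in> malg ns \<Longrightarrow> complete_adjacency ns x =
    cscale (of_real (- 1)) x + cscale (of_real (real (mdim ns)) * psi ns x) (mone ns)"
  by (auto simp: complete_adjacency_def delta_sq cscale_def fun_eq_iff)

lemma complete_degree_apply:
  assumes "x \<in> malg ns" "0 < mdim ns"
  shows "degree_op ns (complete_adjacency ns) x = cscale (of_real (real (mdim ns) - 1)) x"
proof -
  have "complete_adjacency ns (mone ns) = cscale (of_real (real (mdim ns) - 1)) (mone ns)"
    using psi_mone[OF assms(2)]
    by (simp add: complete_adjacency_apply fun_eq_iff cscale_def algebra_simps)
  then show ?thesis using assms(1) by (simp add: degree_op_def mmult_scale mmult_mone)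
qed


section \<open>The lower bound for the number of colors\<close>

definition tensor_weight :: "nat list \<Rightarrow> midx \<times> nat \<Rightarrow> real" where
  "tensor_weight ns = (\<lambda>(p, u). block_weight ns p)"

lemma tensor_form_weighted:
  "ten_form (midx ns) {..<k} (l2_form ns) (std_form {..<k}) =
    weighted_form (midx ns \<times> {..<k}) (tensor_weight ns)"
  by (simp add: l2_form_weighted std_form_weighted ten_form_weighted tensor_weight_def)

lemma tensor_alg_subset_ops:
  assumes "N \<subseteq> ops {..<k} {..<k}"
  shows "tensor_alg ns k N \<subseteq> ops (midx ns \<times> {..<k}) (midx ns \<times> {..<k})"
  unfolding tensor_alg_def
proof (rule cop.span_minimal[OF _ subspace_ops], clarify)
  fix x Y assume "x \<in> malg ns" "Y \<in> N"
  then show "ten_op (midx ns) {..<k} (lmul ns x) Y \<in> ops (midx ns \<times> {..<k}) (midx ns \<times> {..<k})"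
    using assms lmul_in_bl2[of x ns] by (auto simp: bl2_def intro!: ten_op_in_ops)
qed

text \<open>The inner product of \<open>z\<close> with \<open>1 \<otimes> e\<^sub>u\<close>, see \<open>weighted_form_unit\<close>.\<close>

definition unit_slice :: "nat list \<Rightarrow> (midx \<times> nat) cvec \<Rightarrow> nat \<Rightarrow> complex" where
  "unit_slice ns z u = (\<Sum>p\<in>midx ns. block_weight ns p * mone ns p * z (p, u))"

lemma weighted_form_unit:
  assumes "u < k"
  shows "weighted_form (midx ns \<times> {..<k}) (tensor_weight ns) z (ten_vec (mone ns) (ket u)) =
    unit_slice ns z u"
proof -
  have cnj: "cnj (mone ns p) = mone ns p" for p
    by (auto simp: mone_def split: prod.splits)
  have "weighted_form (midx ns \<times> {..<k}) (tensor_weight ns) z (ten_vec (mone ns) (ket u)) =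
      (\<Sum>p\<in>midx ns. \<Sum>u'<k. if u' = u then block_weight ns p * mone ns p * z (p, u) else 0)"
    unfolding weighted_form_def sum.cartesian_product
    by (intro sum.cong) (auto simp: tensor_weight_def ten_vec_def ket_def cnj)
  then show ?thesis using assms by (simp add: unit_slice_def)
qed

text \<open>The vectors \<open>1 \<otimes> e\<^sub>u\<close> are an orthonormal basis of the range of \<open>p \<otimes> I\<close>, where \<open>p\<close> projects onto
  the line of the unit, and the complete adjacency matrix is \<open>d p - I\<close>.\<close>

lemma complete_tensor_form:
  assumes z: "z \<in> cvecs (midx ns \<times> {..<k})"
  defines "G \<equiv> weighted_form (midx ns \<times> {..<k}) (tensor_weight ns)"
  shows "G (ten_op (midx ns) {..<k} (complete_adjacency ns) (id_op {..<k}) z) z =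
    of_nat (mdim ns) * (\<Sum>u<k. unit_slice ns z u * cnj (unit_slice ns z u)) - G z z"
proof -
  let ?I = "midx ns" and ?K = "{..<k}" and ?A = "complete_adjacency ns"
  let ?w = "\<lambda>p. complex_of_real (block_weight ns p)"
  note A = complete_adjacency_in_bl2[of ns, unfolded bl2_def]
  have cnj: "cnj (mone ns p) = mone ns p" for p
    by (auto simp: mone_def split: prod.splits)
  have tensor_apply: "ten_op ?I ?K ?A (id_op ?K) z (p, u) =
      of_nat (mdim ns) * mone ns p * unit_slice ns z u - z (p, u)" if p: "p \<in> ?I" and u: "u < k" for p u
  proof -
    have "ten_op ?I ?K ?A (id_op ?K) z (p, u) =
        (\<Sum>r\<in>?I \<times> ?K. ten_op ?I ?K ?A (id_op ?K) (ket r) (p, u) * z r)"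
      by (rule ops_apply[OF _ ten_op_in_ops[OF _ _ A id_op_in_ops] z]) (use p u in auto)
    also have "\<dots> = (\<Sum>q\<in>?I. \<Sum>u'<k. if u' = u then ?A (ket q) p * z (q, u) else 0)"
      unfolding sum.cartesian_product using p u
      by (intro sum.cong) (auto simp: ten_op_ket[OF _ _ A id_op_in_ops] id_op_ket)
    also have "\<dots> = (\<Sum>q\<in>?I. ?A (ket q) p * z (q, u))"
      using u by simp
    also have "\<dots> = (\<Sum>q\<in>?I. of_nat (mdim ns) * mone ns p * (?w q * mone ns q * z (q, u)) -
        ket q p * z (q, u))"
      by (intro sum.cong refl) (simp add: complete_adjacency_ket algebra_simps)
    also have "\<dots> = of_nat (mdim ns) * mone ns p * unit_slice ns z u - z (p, u)"
      using p by (simp add: sum_subtractf sum_ket unit_slice_def sum_distrib_left)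
    finally show ?thesis .
  qed
  have "G (ten_op ?I ?K ?A (id_op ?K) z) z =
      (\<Sum>p\<in>?I. \<Sum>u<k. ?w p * (of_nat (mdim ns) * mone ns p * unit_slice ns z u - z (p, u)) * cnj (z (p, u)))"
    unfolding G_def weighted_form_def sum.cartesian_product
    by (intro sum.cong refl) (auto simp: tensor_apply tensor_weight_def)
  also have "\<dots> = (\<Sum>p\<in>?I. \<Sum>u<k. of_nat (mdim ns) * (unit_slice ns z u * (?w p * mone ns p * cnj (z (p, u)))))
      - (\<Sum>p\<in>?I. \<Sum>u<k. ?w p * z (p, u) * cnj (z (p, u)))"
    by (simp add: algebra_simps sum_subtractf)
  also have "(\<Sum>p\<in>?I. \<Sum>u<k. ?w p * z (p, u) * cnj (z (p, u))) = G z z"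
    unfolding G_def weighted_form_def sum.cartesian_product
    by (intro sum.cong refl) (auto simp: tensor_weight_def)
  also have "(\<Sum>p\<in>?I. \<Sum>u<k. of_nat (mdim ns) * (unit_slice ns z u * (?w p * mone ns p * cnj (z (p, u))))) =
      (\<Sum>u<k. \<Sum>p\<in>?I. of_nat (mdim ns) * (unit_slice ns z u * (?w p * mone ns p * cnj (z (p, u)))))"
    by (rule sum.swap)
  also have "\<dots> = of_nat (mdim ns) * (\<Sum>u<k. unit_slice ns z u * cnj (unit_slice ns z u))"
    by (simp add: sum_distrib_left[symmetric] unit_slice_def cnj)
  finally show ?thesis .
qed

text \<open>Let \<open>r = \<langle>P\<^sub>a v, v\<rangle> = \<parallel>P\<^sub>a v\<parallel>\<^sup>2\<close> for \<open>v = 1 \<otimes> e\<^sub>0\<close>. Compressing the adjacency matrix to the color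
  \<open>a\<close> gives 0, which says that \<open>r\<close> is \<open>d\<close> times the sum of the squared moduli of the unit slices of
  \<open>P\<^sub>a v\<close>. One of these slices is \<open>r\<close> itself, so \<open>d r\<^sup>2 \<le> r\<close>.\<close>

lemma coloring_lower_bound:
  assumes alg: "fd_vn_algebra k N" and col: "quantum_coloring ns S c k N P"
    and A: "complete_adjacency ns \<in> S" and dim: "0 < mdim ns"
  shows "mdim ns \<le> c"
proof -
  let ?J = "midx ns \<times> {..<k}" and ?d = "real (mdim ns)"
  define G where "G = weighted_form ?J (tensor_weight ns)"
  define v where "v = ten_vec (mone ns) (ket (0::nat))"
  have k: "0 < k" and N: "N \<subseteq> ops {..<k} {..<k}" using alg by (auto simp: fd_vn_algebra_def)
  have v: "v \<in> cvecs ?J"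
    using k mone_in_malg[of ns] by (auto simp: v_def ten_vec_def cvecs_def malg_def ket_def)
  have finJ: "finite ?J" by simp
  define r where "r = (\<lambda>a. Re (G (P a v) v))"
  have step: "G (P a v) v = of_real (r a) \<and> ?d * r a \<le> 1" if a: "a \<in> {1..c}" for a
  proof -
    have P: "P a \<in> ops ?J ?J" using col a tensor_alg_subset_ops[OF N]
      unfolding quantum_coloring_def by blast
    have idem: "P a (P a x) = P a x" for x
      using col a unfolding quantum_coloring_def by (metis comp_apply)
    have sa: "G (P a x) y = G x (P a y)" if "x \<in> cvecs ?J" "y \<in> cvecs ?J" for x y
    proof -
      have "adj ?J G ?J G (P a) = P a"
        using col a unfolding quantum_coloring_def tensor_adj_def tensor_form_weighted G_def by blast
      then show ?thesis
        using adj_weighted(2)[OF finJ finJ P _ that, of "tensor_weight ns" "tensor_weight ns"]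
        by (auto simp: G_def tensor_weight_def block_weight_pos)
    qed
    define w where "w = P a v"
    define X where "X = ten_op (midx ns) {..<k} (complete_adjacency ns) (id_op {..<k})"
    have w: "w \<in> cvecs ?J" unfolding w_def by (rule ops_closed[OF P v])
    have Xw: "X w \<in> cvecs ?J"
      unfolding X_def using complete_adjacency_in_bl2[of ns]
      by (intro ops_closed[OF ten_op_in_ops w] id_op_in_ops) (auto simp: bl2_def)
    have "P a \<circ> X \<circ> P a = 0"
      using col a A unfolding quantum_coloring_def X_def by blast
    then have "P a (X w) = 0" unfolding w_def by (metis comp_apply zero_fun_apply)
    then have "0 = G (P a (X w)) v" by (simp add: G_def weighted_form_def)
    also have "\<dots> = G (X w) w" using sa[OF Xw v] by (simp add: w_def)
    also have "\<dots> = of_nat (mdim ns) * (\<Sum>u<k. unit_slice ns w u * cnj (unit_slice ns w u)) - G w w"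
      unfolding X_def G_def by (rule complete_tensor_form[OF w])
    finally have eq: "G w w = of_nat (mdim ns) * (\<Sum>u<k. unit_slice ns w u * cnj (unit_slice ns w u))"
      by simp
    have "G w w = G w v" using sa[OF w v] by (simp add: w_def idem)
    also have "\<dots> = unit_slice ns w 0" unfolding G_def v_def by (rule weighted_form_unit[OF k])
    finally have slice: "unit_slice ns w 0 = G w w" by simp
    have "G w w = of_real (?d * (\<Sum>u<k. (cmod (unit_slice ns w u))\<^sup>2))"
      unfolding eq by (simp add: complex_norm_square[symmetric])
    then obtain t where t: "G w w = of_real t" and t_eq: "t = ?d * (\<Sum>u<k. (cmod (unit_slice ns w u))\<^sup>2)"
      by blast
    have "t\<^sup>2 = (cmod (unit_slice ns w 0))\<^sup>2" by (simp add: slice t)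
    also have "\<dots> \<le> (\<Sum>u<k. (cmod (unit_slice ns w u))\<^sup>2)"
      using k by (intro member_le_sum) auto
    finally have "?d * t\<^sup>2 \<le> t" unfolding t_eq by (simp add: mult_left_mono)
    moreover have "0 \<le> t" unfolding t_eq by (simp add: sum_nonneg)
    ultimately have "?d * t \<le> 1"
      by (cases "t = 0") (auto simp: power2_eq_square mult_le_cancel_right2 simp flip: mult.assoc)
    moreover have "G (P a v) v = of_real t"
      using slice t \<open>G w v = unit_slice ns w 0\<close> by (simp add: w_def)
    ultimately show ?thesis by (simp add: r_def)
  qed
  have "(\<Sum>a\<in>{1..c}. G (P a v) v) = G ((\<Sum>a\<in>{1..c}. P a) v) v"
    unfolding G_def weighted_form_def sum_fun_apply
    by (subst sum.swap) (simp add: sum_distrib_left sum_distrib_right)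
  also have "(\<Sum>a\<in>{1..c}. P a) v = v"
    using col v unfolding quantum_coloring_def by (simp add: id_op_def)
  also have "G v v = unit_slice ns v 0"
    unfolding G_def by (subst (2) v_def) (rule weighted_form_unit[OF k])
  also have "\<dots> = psi ns (mone ns)"
    by (simp add: unit_slice_def psi_weighted v_def ten_vec_def ket_def)
  finally have "(\<Sum>a\<in>{1..c}. complex_of_real (r a)) = 1"
    using step psi_mone[OF dim] by simp
  then have "(\<Sum>a\<in>{1..c}. r a) = 1"
    by (metis of_real_eq_1_iff of_real_sum)
  then have "?d = (\<Sum>a\<in>{1..c}. ?d * r a)" by (simp flip: sum_distrib_left)
  also have "\<dots> \<le> (\<Sum>a\<in>{1..c}. 1)" using step by (intro sum_mono) auto
  finally show ?thesis by simp
qed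


section \<open>A coloring from Weyl unitaries\<close>

text \<open>The power \<open>t u\<close> of a primitive \<open>n\<close>-th root of unity.\<close>

definition phase :: "nat \<Rightarrow> nat \<Rightarrow> nat \<Rightarrow> complex" where
  "phase n t u = cis (2 * pi * (real t * real u / real n))"

lemma phase_mult_cnj [simp]: "phase n t u * cnj (phase n t u) = 1"
  by (simp add: phase_def cis_cnj cis_mult)

text \<open>Orthogonality of the characters of the cyclic group of order \<open>n\<close>: the summands are the powers of
  an \<open>n\<close>-th root of unity, which is 1 exactly if \<open>u\<close> and \<open>v\<close> are congruent.\<close>

lemma sum_phase:
  assumes n: "0 < n"
  shows "(\<Sum>t<n. phase n t u * cnj (phase n t v)) = (if u mod n = v mod n then of_nat n else 0)"
proof -
  define x where "x = (real u - real v) / real n"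
  define \<zeta> where "\<zeta> = cis (2 * pi * x)"
  have pow: "phase n t u * cnj (phase n t v) = \<zeta> ^ t" for t
    unfolding \<zeta>_def DeMoivre phase_def cis_cnj cis_mult x_def
    by (rule arg_cong[where f = cis]) (simp add: field_simps diff_divide_distrib)
  have "\<zeta> ^ n = cis (2 * pi * real_of_int (int u - int v))"
    unfolding \<zeta>_def DeMoivre x_def using n by simp
  then have pow_n: "\<zeta> ^ n = 1" using cis_multiple_2pi Ints_of_int by metis
  show ?thesis
  proof (cases "\<zeta> = 1")
    case True
    then have "cos (2 * pi * x) = 1"
      by (metis \<zeta>_def cis.simps(1) one_complex.sel(1))
    then obtain m :: int where "2 * pi * x = of_int m * 2 * pi"
      unfolding cos_one_2pi_int by blast
    then have "x = of_int m" by simp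
    then have "real_of_int (int u - int v) = real_of_int (m * int n)" using n by (simp add: x_def field_simps)
    then have "int u - int v = m * int n" by (simp only: of_int_eq_iff)
    then have "int u mod int n = int v mod int n" by (simp add: mod_eq_dvd_iff)
    then have "u mod n = v mod n" by (simp flip: of_nat_mod)
    then show ?thesis using True by (simp add: pow)
  next
    case False
    have "u mod n \<noteq> v mod n"
    proof
      assume "u mod n = v mod n"
      then have "int n dvd int u - int v" by (metis mod_eq_dvd_iff of_nat_mod)
      then obtain m where "int u - int v = int n * m" by (elim dvdE)
      then have "real u - real v = real n * of_int m"
        by (metis of_int_diff of_int_mult of_int_of_nat_eq)
      then have "\<zeta> = cis (2 * pi * of_int m)" using n by (simp add: \<zeta>_def x_def)
      then show False using False by simp
    qed
    then show ?thesis using False pow_n by (simp add: pow geometric_sum)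
  qed
qed

text \<open>Each of the intervals of length \<open>n\<close> starting at a multiple of \<open>n\<close> is a complete system of
  residues, and remains one after a shift.\<close>

lemma sum_block_shift:
  fixes g :: "nat \<Rightarrow> 'a::comm_monoid_add"
  assumes n: "0 < n" and "n dvd k" and b: "b < k div n"
  shows "(\<Sum>v<k. if v div n = b then g ((v + s) mod n) else 0) = (\<Sum>j<n. g j)"
proof -
  define B where "B = {b * n..<b * n + n}"
  have B: "v \<in> B \<longleftrightarrow> v div n = b" for v
    unfolding B_def using n by (auto simp: div_nat_eqI dividend_less_times_div mult.commute)
      (metis add.commute dividend_less_times_div mult.commute)
  have "B \<subseteq> {..<k}"
  proof -
    have "b * n + n \<le> (k div n) * n" using b by (metis Suc_leI add.commute mult_Suc mult_le_mono1)
    then show ?thesis using \<open>n dvd k\<close> by (auto simp: B_def)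
  qed
  have inj: "inj_on (\<lambda>v. (v + s) mod n) B"
  proof (rule inj_onI)
    fix v v' assume v: "v \<in> B" "v' \<in> B" and "(v + s) mod n = (v' + s) mod n"
    then have "int n dvd int (v + s) - int (v' + s)" by (metis mod_eq_dvd_iff of_nat_mod)
    then have "int v mod int n = int v' mod int n" by (simp add: mod_eq_dvd_iff)
    then have "v mod n = v' mod n" by (simp flip: of_nat_mod)
    then show "v = v'" using v by (metis B div_mult_mod_eq)
  qed
  have "(\<lambda>v. (v + s) mod n) ` B = {..<n}"
    using card_image[OF inj] n by (intro card_subset_eq) (auto simp: B_def)
  then have "(\<Sum>j<n. g j) = (\<Sum>v\<in>B. g ((v + s) mod n))"
    using sum.reindex[OF inj, of g] by simp
  also have "\<dots> = (\<Sum>v\<in>{v \<in> {..<k}. v div n = b}. g ((v + s) mod n))"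
    using \<open>B \<subseteq> {..<k}\<close> B by (intro sum.cong) auto
  also have "\<dots> = (\<Sum>v<k. if v div n = b then g ((v + s) mod n) else 0)"
    by (rule sum.inter_filter) simp
  finally show ?thesis by simp
qed

text \<open>The Hilbert space with basis \<open>{..<k}\<close> is split into consecutive copies of \<open>\<complex>\<^sup>n\<close>, indexed by
  \<open>u div n\<close>. In each copy, the Weyl unitary \<open>e\<^sub>u \<mapsto> \<omega>\<^sup>t\<^sup>u e\<^sub>u\<^sub>+\<^sub>s\<close> defines the maximally entangled vector
  \<open>n\<^sup>-\<^sup>1\<^sup>/\<^sup>2 \<Sum>\<^sub>u \<omega>\<^sup>t\<^sup>u e\<^sub>u\<^sub>+\<^sub>s \<otimes> e\<^sub>u\<close>. The entries are those of the sum of the projections onto these vectors,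
  tensored with the identity on the factor of \<open>L\<^sup>2\<close> on which left multiplications are trivial. The
  colors \<open>(i, s, t)\<close> are thus indexed by the index set of the algebra itself.\<close>

definition weyl_entry :: "nat list \<Rightarrow> midx \<Rightarrow> midx \<times> nat \<Rightarrow> midx \<times> nat \<Rightarrow> complex" where
  "weyl_entry ns = (\<lambda>(i, s, t) ((i1, j, l), u) ((i2, j', l'), u').
     let n = ns ! i in
     if i1 = i \<and> i2 = i \<and> l = l' \<and> u div n = u' div n \<and> j = (u + s) mod n \<and> j' = (u' + s) mod n
     then phase n t u * cnj (phase n t u') / of_nat n else 0)"

definition weyl_projection :: "nat list \<Rightarrow> nat \<Rightarrow> midx \<Rightarrow> (midx \<times> nat, midx \<times> nat) op" where
  "weyl_projection ns k a = mat_op (midx ns \<times> {..<k}) (midx ns \<times> {..<k}) (weyl_entry ns a)"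

lemma weyl_entry_cnj: "cnj (weyl_entry ns a z z') = weyl_entry ns a z' z"
  by (auto simp: weyl_entry_def Let_def split: prod.splits)

text \<open>For a fixed index \<open>u\<close> of the second tensor factor, every column has at most one nonzero entry,
  because \<open>u\<close> determines the shifted index.\<close>

lemma sum_weyl_entry_left:
  assumes a: "(i, s, t) \<in> midx ns" and q: "(i', j', l') \<in> midx ns"
  shows "(\<Sum>p\<in>midx ns. weyl_entry ns (i, s, t) (p, u) ((i', j', l'), u') * f p) =
    (if i' = i \<and> u div ns ! i = u' div ns ! i \<and> j' = (u' + s) mod ns ! i
     then phase (ns ! i) t u * cnj (phase (ns ! i) t u') / of_nat (ns ! i) * f (i, (u + s) mod ns ! i, l')
     else 0)" (is "_ = (if ?c then ?x else 0)")
proof -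
  have "(\<Sum>p\<in>midx ns. weyl_entry ns (i, s, t) (p, u) ((i', j', l'), u') * f p) =
      (\<Sum>p\<in>midx ns. if p = (i, (u + s) mod ns ! i, l') then if ?c then ?x else 0 else 0)"
    by (rule sum.cong[OF refl]) (auto simp: weyl_entry_def Let_def split: prod.splits)
  also have "\<dots> = (if ?c then ?x else 0)"
    using a q by (auto simp: midx_iff)
  finally show ?thesis .
qed

lemma sum_weyl_entry_right:
  assumes a: "(i, s, t) \<in> midx ns" and p: "(i', j, l) \<in> midx ns"
  shows "(\<Sum>q\<in>midx ns. weyl_entry ns (i, s, t) ((i', j, l), u) (q, u') * f q) =
    (if i' = i \<and> u div ns ! i = u' div ns ! i \<and> j = (u + s) mod ns ! i
     then phase (ns ! i) t u * cnj (phase (ns ! i) t u') / of_nat (ns ! i) * f (i, (u' + s) mod ns ! i, l)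
     else 0)" (is "_ = (if ?c then ?x else 0)")
proof -
  have "(\<Sum>q\<in>midx ns. weyl_entry ns (i, s, t) ((i', j, l), u) (q, u') * f q) =
      (\<Sum>q\<in>midx ns. if q = (i, (u' + s) mod ns ! i, l) then if ?c then ?x else 0 else 0)"
    by (rule sum.cong[OF refl]) (auto simp: weyl_entry_def Let_def split: prod.splits)
  also have "\<dots> = (if ?c then ?x else 0)"
    using a p by (auto simp: midx_iff)
  finally show ?thesis .
qed

lemma weyl_projection_in_ops:
  "weyl_projection ns k a \<in> ops (midx ns \<times> {..<k}) (midx ns \<times> {..<k})"
  by (simp add: weyl_projection_def mat_op_in_ops)

lemma weyl_projection_ket:
  assumes "z \<in> midx ns \<times> {..<k}" "z' \<in> midx ns \<times> {..<k}"
  shows "weyl_projection ns k a (ket z') z = weyl_entry ns a z z'"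
  using assms unfolding weyl_projection_def by (intro mat_op_ket) auto

text \<open>Maximal entanglement: in \<open>P (X \<otimes> I) P\<close> the phases of the inner index \<open>v\<close> cancel, and as \<open>v\<close> runs
  over a block of length \<open>n\<close> its shift runs over all residues, which turns the sum over \<open>v\<close> into a
  partial trace of \<open>X\<close>.\<close>

lemma weyl_compression_ket:
  assumes a: "(i, s, t) \<in> midx ns" and dvd: "ns ! i dvd k" and X: "X \<in> bl2 ns"
    and z: "(i1, j, l) \<in> midx ns" "u < k" and z': "(i2, j', l') \<in> midx ns" "u' < k"
  defines "P \<equiv> weyl_projection ns k (i, s, t)" and "n \<equiv> ns ! i"
  shows "(P \<circ> (ten_op (midx ns) {..<k} X (id_op {..<k}) \<circ> P)) (ket ((i2, j', l'), u')) ((i1, j, l), u) =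
    (if i1 = i \<and> i2 = i \<and> u div n = u' div n \<and> j = (u + s) mod n \<and> j' = (u' + s) mod n
     then phase n t u * cnj (phase n t u') * slice_trace ns (i, l, l') X / (of_nat n)\<^sup>2 else 0)"
    (is "_ = (if ?c then ?r else 0)")
proof -
  let ?J = "midx ns \<times> {..<k}" and ?X = "ten_op (midx ns) {..<k} X (id_op {..<k})"
  let ?z = "((i1, j, l), u)" and ?z' = "((i2, j', l'), u')" and ?ph = "phase n t"
  let ?W = "weyl_entry ns (i, s, t)"
  have n: "0 < n" using a by (auto simp: n_def midx_iff)
  have P: "P \<in> ops ?J ?J" by (simp add: P_def weyl_projection_in_ops)
  note X' = X[unfolded bl2_def]
  have XI: "?X \<in> ops ?J ?J" by (rule ten_op_in_ops[OF _ _ X' id_op_in_ops]) auto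
  have fin: "finite ?J" by simp
  have XP: "(?X \<circ> P) (ket ?z') (p, v) =
      (if i2 = i \<and> v div n = u' div n \<and> j' = (u' + s) mod n
       then ?ph v * cnj (?ph u') / of_nat n * X (ket (i, (v + s) mod n, l')) p else 0)"
    if p: "p \<in> midx ns" and v: "v < k" for p v
  proof -
    have "(?X \<circ> P) (ket ?z') (p, v) = (\<Sum>y\<in>?J. ?X (ket y) (p, v) * P (ket ?z') y)"
      by (rule comp_ket[OF fin P XI]) (use p v z' in auto)
    also have "\<dots> = (\<Sum>q\<in>midx ns. \<Sum>v'<k. if v' = v then ?W (q, v) ?z' * X (ket q) p else 0)"
      unfolding sum.cartesian_product using p v z'
      by (intro sum.cong)
        (auto simp: ten_op_ket[OF _ _ X' id_op_in_ops] id_op_ket P_def weyl_projection_ket)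
    also have "\<dots> = (\<Sum>q\<in>midx ns. ?W (q, v) ?z' * X (ket q) p)" using v by simp
    finally show ?thesis using sum_weyl_entry_left[OF a z'(1)] by (simp add: n_def)
  qed
  have "(P \<circ> (?X \<circ> P)) (ket ?z') ?z = (\<Sum>y\<in>?J. P (ket y) ?z * (?X \<circ> P) (ket ?z') y)"
    by (rule comp_ket[OF fin ops_comp[OF P XI] P]) (use z z' in auto)
  also have "\<dots> = (\<Sum>p\<in>midx ns. \<Sum>v<k. ?W ?z (p, v) * (?X \<circ> P) (ket ?z') (p, v))"
    unfolding sum.cartesian_product using z
    by (intro sum.cong) (auto simp: P_def weyl_projection_ket)
  also have "\<dots> = (\<Sum>v<k. \<Sum>p\<in>midx ns. ?W ?z (p, v) * (?X \<circ> P) (ket ?z') (p, v))"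
    by (rule sum.swap)
  also have "\<dots> = (\<Sum>v<k. if v div n = u div n
      then if ?c then ?ph u * cnj (?ph u') / (of_nat n)\<^sup>2 *
        X (ket (i, (v + s) mod n, l')) (i, (v + s) mod n, l) else 0 else 0)"
  proof (rule sum.cong[OF refl])
    fix v assume "v \<in> {..<k}"
    then have v: "v < k" by simp
    have "?ph u * cnj (?ph v) * (?ph v * cnj (?ph u')) = ?ph u * cnj (?ph u')"
      using phase_mult_cnj[of n t v] by (simp add: mult_ac del: phase_mult_cnj)
    then have ph: "?ph u * cnj (?ph v) / of_nat n * (?ph v * cnj (?ph u') / of_nat n * x) =
        ?ph u * cnj (?ph u') / (of_nat n)\<^sup>2 * x" for x
      by (simp add: power2_eq_square flip: mult.assoc)
    have mem: "(i, (v + s) mod n, l) \<in> midx ns" if "i1 = i"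
      using z a that by (auto simp: midx_iff n_def)
    show "(\<Sum>p\<in>midx ns. ?W ?z (p, v) * (?X \<circ> P) (ket ?z') (p, v)) =
      (if v div n = u div n then if ?c then ?ph u * cnj (?ph u') / (of_nat n)\<^sup>2 *
        X (ket (i, (v + s) mod n, l')) (i, (v + s) mod n, l) else 0 else 0)"
      unfolding sum_weyl_entry_right[OF a z(1)] n_def[symmetric]
      using ph by (cases "i1 = i") (simp_all only: XP[OF mem v], auto)
  qed
  also have "\<dots> = (if ?c then \<Sum>v<k. if v div n = u div n
      then ?ph u * cnj (?ph u') / (of_nat n)\<^sup>2 *
        X (ket (i, (v + s) mod n, l')) (i, (v + s) mod n, l) else 0 else 0)"
  proof (cases ?c)
    case True
    show ?thesis unfolding if_P[OF True] ..
  next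
    case False
    show ?thesis unfolding if_not_P[OF False] by simp
  qed
  also have "(\<Sum>v<k. if v div n = u div n then ?ph u * cnj (?ph u') / (of_nat n)\<^sup>2 *
        X (ket (i, (v + s) mod n, l')) (i, (v + s) mod n, l) else 0) =
      (\<Sum>m<n. ?ph u * cnj (?ph u') / (of_nat n)\<^sup>2 * X (ket (i, m, l')) (i, m, l))"
    using dvd z(2) n
    by (intro sum_block_shift[where g = "\<lambda>m. ?ph u * cnj (?ph u') / (of_nat n)\<^sup>2 *
        X (ket (i, m, l')) (i, m, l)"]) (auto simp: n_def less_mult_imp_div_less)
  also have "\<dots> = ?r"
    by (simp add: slice_trace_def n_def sum_distrib_left sum_divide_distrib)
  finally show ?thesis .
qed

text \<open>Since the identity has the slice traces \<open>n\<close> on the diagonal, its compression is the projection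
  itself.\<close>

lemma weyl_projection_idem:
  assumes a: "(i, s, t) \<in> midx ns" and dvd: "ns ! i dvd k"
  shows "weyl_projection ns k (i, s, t) \<circ> weyl_projection ns k (i, s, t) = weyl_projection ns k (i, s, t)"
proof -
  let ?P = "weyl_projection ns k (i, s, t)" and ?J = "midx ns \<times> {..<k}"
  let ?E = "ten_op (midx ns) {..<k} (id_op (midx ns)) (id_op {..<k})"
  have P: "?P \<in> ops ?J ?J" by (rule weyl_projection_in_ops)
  have E: "?E = id_op ?J"
    by (rule ops_eqI[of ?J _ ?J]) (auto simp: ten_op_in_ops id_op_in_ops ten_op_ket[OF _ _ id_op_in_ops id_op_in_ops] id_op_ket
        split: if_splits)
  have "?E \<circ> ?P = ?P"
    unfolding E by (rule id_op_comp[OF P])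
  moreover have "?P \<circ> (?E \<circ> ?P) = ?P"
  proof (rule ops_eqI[of ?J _ ?J])
    fix z z' assume z: "z \<in> ?J" "z' \<in> ?J"
    obtain i1 j l u where [simp]: "z = ((i1, j, l), u)" by (metis prod.exhaust)
    obtain i2 j' l' u' where [simp]: "z' = ((i2, j', l'), u')" by (metis prod.exhaust)
    have tr: "slice_trace ns (i, l, l') (id_op (midx ns)) = (if l = l' then of_nat (ns ! i) else 0)"
      if "i1 = i" "i2 = i"
      using z that by (simp add: slice_trace_def id_op_ket midx_iff)
    have n: "of_nat (ns ! i) \<noteq> (0 :: complex)" using a by (auto simp: midx_iff)
    have "(?P \<circ> (?E \<circ> ?P)) (ket z') z = weyl_entry ns (i, s, t) z z'"
      using weyl_compression_ket[OF a dvd id_op_in_ops[of "midx ns", folded bl2_def], of i1 j l u i2 j' l' u']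
        z tr n
      by (auto simp: weyl_entry_def Let_def power2_eq_square)
    then show "(?P \<circ> (?E \<circ> ?P)) (ket z') z = ?P (ket z') z"
      using weyl_projection_ket[OF z] by simp
  qed (use P E in \<open>auto intro!: ops_comp id_op_in_ops\<close>)
  ultimately show ?thesis by simp
qed

lemma weyl_projection_compression:
  assumes a: "(i, s, t) \<in> midx ns" and dvd: "ns ! i dvd k" and X: "X \<in> bl2 ns"
    and slice: "\<And>p. p \<in> midx ns \<Longrightarrow> slice_trace ns p X = 0"
  shows "weyl_projection ns k (i, s, t) \<circ> ten_op (midx ns) {..<k} X (id_op {..<k}) \<circ>
    weyl_projection ns k (i, s, t) = 0"
proof -
  let ?P = "weyl_projection ns k (i, s, t)" and ?J = "midx ns \<times> {..<k}"
  let ?X = "ten_op (midx ns) {..<k} X (id_op {..<k})"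
  have P: "?P \<in> ops ?J ?J" by (rule weyl_projection_in_ops)
  have XI: "?X \<in> ops ?J ?J"
    by (rule ten_op_in_ops[OF _ _ X[unfolded bl2_def] id_op_in_ops]) auto
  have "?P \<circ> (?X \<circ> ?P) = 0"
  proof (rule ops_eqI[of ?J _ ?J])
    fix z z' assume z: "z \<in> ?J" "z' \<in> ?J"
    obtain i1 j l u where [simp]: "z = ((i1, j, l), u)" by (metis prod.exhaust)
    obtain i2 j' l' u' where [simp]: "z' = ((i2, j', l'), u')" by (metis prod.exhaust)
    have "slice_trace ns (i, l, l') X = 0" if "i1 = i" "i2 = i"
      using z that by (intro slice) (auto simp: midx_iff)
    then show "(?P \<circ> (?X \<circ> ?P)) (ket z') z = 0 (ket z') z"
      using weyl_compression_ket[OF a dvd X, of i1 j l u i2 j' l' u'] z by auto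
  qed (use P XI in \<open>auto intro!: ops_comp cop.subspace_0[OF subspace_ops]\<close>)
  then show ?thesis by (simp add: comp_assoc)
qed

text \<open>The matrix is Hermitian, and it only connects indices of one block, where the weights agree.\<close>

lemma weyl_projection_adj: "tensor_adj ns k (weyl_projection ns k a) = weyl_projection ns k a"
proof -
  let ?P = "weyl_projection ns k a" and ?J = "midx ns \<times> {..<k}"
  have P: "?P \<in> ops ?J ?J" by (rule weyl_projection_in_ops)
  have pos: "0 < tensor_weight ns z" if "z \<in> ?J" for z
    using that by (auto simp: tensor_weight_def block_weight_pos)
  have same: "tensor_weight ns z = tensor_weight ns z'" if "weyl_entry ns a z z' \<noteq> 0" for z z'
    using that by (auto simp: weyl_entry_def Let_def tensor_weight_def block_weight_def split: prod.splits if_splits)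
  have "tensor_adj ns k ?P =
      mat_op ?J ?J (\<lambda>z z'. cnj (?P (ket z) z') * tensor_weight ns z' / tensor_weight ns z)"
    unfolding tensor_adj_def tensor_form_weighted by (rule adj_weighted(1)[OF _ _ P pos]) auto
  also have "\<dots> = ?P"
    unfolding weyl_projection_def
  proof (rule mat_op_cong)
    fix z z' assume z: "z \<in> ?J" "z' \<in> ?J"
    have "complex_of_real (tensor_weight ns z) \<noteq> 0" using pos[OF z(1)] by simp
    then show "cnj (mat_op ?J ?J (weyl_entry ns a) (ket z) z') * tensor_weight ns z' / tensor_weight ns z =
        weyl_entry ns a z z'"
      using same[of z z'] z by (cases "weyl_entry ns a z z' = 0") (auto simp: weyl_entry_cnj)
  qed
  finally show ?thesis .
qed

text \<open>Summing over \<open>t\<close> forces \<open>u\<close> and \<open>u'\<close> to be congruent modulo \<open>n\<close>, hence equal within one copy of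
  \<open>\<complex>\<^sup>n\<close>. Exactly one shift \<open>s\<close> then takes \<open>u\<close> to \<open>j\<close>.\<close>

lemma sum_weyl_projection:
  "(\<Sum>a\<in>midx ns. weyl_projection ns k a) = id_op (midx ns \<times> {..<k})"
proof (rule ops_eqI[of "midx ns \<times> {..<k}" _ "midx ns \<times> {..<k}"])
  let ?J = "midx ns \<times> {..<k}"
  show "(\<Sum>a\<in>midx ns. weyl_projection ns k a) \<in> ops ?J ?J"
    by (intro cop.subspace_sum subspace_ops weyl_projection_in_ops)
  fix z z' assume z: "z \<in> ?J" "z' \<in> ?J"
  obtain i1 j l u where z1: "z = ((i1, j, l), u)" by (metis prod.exhaust)
  obtain i2 j' l' u' where z2: "z' = ((i2, j', l'), u')" by (metis prod.exhaust)
  have inner: "(\<Sum>t<ns ! i. weyl_entry ns (i, s, t) z z') =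
      (if i = i1 \<and> j = (u + s) mod ns ! i \<and> z = z' then 1 else 0)"
    if i: "i < length ns" "s < ns ! i" for i s
  proof -
    let ?n = "ns ! i"
    let ?c = "i1 = i \<and> i2 = i \<and> l = l' \<and> u div ?n = u' div ?n \<and> j = (u + s) mod ?n \<and> j' = (u' + s) mod ?n"
    have n: "0 < ?n" using i by simp
    have "(\<Sum>t<?n. weyl_entry ns (i, s, t) z z') =
        (\<Sum>t<?n. (if ?c then 1 / of_nat ?n else 0) * (phase ?n t u * cnj (phase ?n t u')))"
      by (intro sum.cong refl) (simp add: weyl_entry_def Let_def z1 z2)
    also have "\<dots> = (if ?c then 1 / of_nat ?n else 0) * (if u mod ?n = u' mod ?n then of_nat ?n else 0)"
      by (simp only: sum_distrib_left[symmetric] sum_phase[OF n])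
    also have "\<dots> = (if ?c \<and> u mod ?n = u' mod ?n then 1 else 0)"
      using n by (cases ?c; cases "u mod ?n = u' mod ?n") simp_all
    also have "(?c \<and> u mod ?n = u' mod ?n) = (i = i1 \<and> j = (u + s) mod ?n \<and> z = z')"
      unfolding z1 z2 prod.inject using div_mult_mod_eq[of u ?n] div_mult_mod_eq[of u' ?n] by metis
    finally show ?thesis .
  qed
  have "(\<Sum>a\<in>midx ns. weyl_projection ns k a) (ket z') z = (\<Sum>a\<in>midx ns. weyl_entry ns a z z')"
    by (simp add: sum_fun_apply weyl_projection_ket[OF z])
  also have "\<dots> = (\<Sum>i<length ns. \<Sum>s<ns ! i. if i = i1 \<and> j = (u + s) mod ns ! i \<and> z = z' then 1 else 0)"
    unfolding sum_midx by (intro sum.cong refl) (auto simp: inner)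
  also have "\<dots> = (\<Sum>i<length ns. if i = i1 then if z = z' then 1 else 0 else 0)"
  proof (rule sum.cong[OF refl])
    fix i assume i: "i \<in> {..<length ns}"
    have "(\<Sum>s<ns ! i1. if s div ns ! i1 = 0 then if j = (s + u) mod ns ! i1 then 1 else 0 else 0) =
        (\<Sum>m<ns ! i1. if j = m then 1 else 0 :: complex)"
      using z z1
      by (intro sum_block_shift[where g = "\<lambda>m. if j = m then 1 else 0"]) (auto simp: midx_iff)
    also have "\<dots> = 1" using z z1 by (simp add: midx_iff)
    finally have "(\<Sum>s<ns ! i1. if j = (u + s) mod ns ! i1 then 1 else 0 :: complex) = 1"
      by (simp add: add.commute)
    then show "(\<Sum>s<ns ! i. if i = i1 \<and> j = (u + s) mod ns ! i \<and> z = z' then 1 else 0 :: complex) =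
        (if i = i1 then if z = z' then 1 else 0 else 0)"
      by (cases "i = i1"; cases "z = z'") auto
  qed
  also have "\<dots> = id_op ?J (ket z') z"
    using z z1 by (simp add: id_op_ket midx_iff)
  finally show "(\<Sum>a\<in>midx ns. weyl_projection ns k a) (ket z') z = id_op ?J (ket z') z" .
qed (auto simp: id_op_in_ops)

lemma weyl_projection_in_tensor_alg:
  assumes a: "(i, s, t) \<in> midx ns"
  shows "weyl_projection ns k (i, s, t) \<in> tensor_alg ns k (ops {..<k} {..<k})"
proof -
  let ?n = "ns ! i" and ?J = "midx ns \<times> {..<k}" and ?K = "{..<k}"
  \<comment> \<open>The entry does not depend on the common third index \<open>l\<close>, so 0 serves for all \<open>l\<close>.\<close>
  define Y where "Y = (\<lambda>j j'. mat_op ?K ?K (\<lambda>u u'. weyl_entry ns (i, s, t) ((i, j, 0), u) ((i, j', 0), u')))"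
  let ?T = "\<lambda>j j'. ten_op (midx ns) ?K (lmul ns (ket (i, j, j'))) (Y j j')"
  have Y: "Y j j' \<in> ops ?K ?K" for j j' by (simp add: Y_def mat_op_in_ops)
  have ket: "ket (i, j, j') \<in> malg ns" if "j < ?n" "j' < ?n" for j j'
    using a that by (simp add: malg_def midx_iff)
  note L = lmul_in_bl2[OF ket, unfolded bl2_def]
  have "weyl_projection ns k (i, s, t) = (\<Sum>j<?n. \<Sum>j'<?n. ?T j j')"
  proof (rule ops_eqI[of ?J _ ?J])
    show "(\<Sum>j<?n. \<Sum>j'<?n. ?T j j') \<in> ops ?J ?J"
      by (intro cop.subspace_sum subspace_ops ten_op_in_ops L Y) auto
    fix z z' assume z: "z \<in> ?J" "z' \<in> ?J"
    obtain i1 j1 l u where z1: "z = ((i1, j1, l), u)" by (metis prod.exhaust)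
    obtain i2 j2 l' u' where z2: "z' = ((i2, j2, l'), u')" by (metis prod.exhaust)
    have T: "?T j j' (ket z') z =
        (if j' = j2 then if j = j1 then weyl_entry ns (i, s, t) z z' else 0 else 0)"
      if j: "j < ?n" "j' < ?n" for j j'
    proof -
      have "?T j j' (ket z') z = mmult ns (ket (i, j, j')) (ket (i2, j2, l')) (i1, j1, l) * Y j j' (ket u') u"
        using z j unfolding z1 z2
        by (subst ten_op_ket[OF _ _ L Y]) (auto simp: lmul_def malg_def)
      also have "\<dots> = (if i1 = i \<and> j1 = j \<and> i2 = i \<and> j2 = j' \<and> l = l' then Y j j' (ket u') u else 0)"
        using a j by (subst mmult_ket_left) (auto simp: midx_iff ket_def)
      also have "\<dots> = (if j' = j2 then if j = j1 then weyl_entry ns (i, s, t) z z' else 0 else 0)"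
        using z by (auto simp: Y_def z1 z2 weyl_entry_def Let_def)
      finally show ?thesis .
    qed
    have "(\<Sum>j<?n. \<Sum>j'<?n. ?T j j') (ket z') z = (\<Sum>j<?n. \<Sum>j'<?n. ?T j j' (ket z') z)"
      by (simp add: sum_fun_apply)
    also have "\<dots> = (\<Sum>j<?n. \<Sum>j'<?n. if j' = j2 then if j = j1 then weyl_entry ns (i, s, t) z z' else 0 else 0)"
      by (intro sum.cong refl T) auto
    also have "\<dots> = (if j2 < ?n \<and> j1 < ?n then weyl_entry ns (i, s, t) z z' else 0)"
      by (cases "j2 < ?n") auto
    also have "\<dots> = weyl_entry ns (i, s, t) z z'"
      using z by (auto simp: z1 z2 weyl_entry_def Let_def midx_iff)
    finally show "weyl_projection ns k (i, s, t) (ket z') z = (\<Sum>j<?n. \<Sum>j'<?n. ?T j j') (ket z') z"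
      using weyl_projection_ket[OF z] by simp
  qed (auto simp: weyl_projection_in_ops)
  also have "\<dots> \<in> tensor_alg ns k (ops ?K ?K)"
    unfolding tensor_alg_def using ket Y by (intro cop.span_sum cop.span_base) blast
  finally show ?thesis .
qed

text \<open>Faithfulness of the trace: the trace of \<open>X\<^sup>* X\<close> is the sum of the squared moduli of the entries
  of \<open>X\<close>.\<close>

lemma full_matrix_algebra:
  assumes "0 < k"
  shows "fd_vn_algebra k (ops {..<k} {..<k})"
    and "faithful_trace k (ops {..<k} {..<k}) (op_trace {..<k})"
proof -
  let ?K = "{..<k}"
  have adj: "std_adj k X = mat_op ?K ?K (\<lambda>p q. cnj (X (ket p) q))" if "X \<in> ops ?K ?K" for X
    unfolding std_adj_def std_form_weighted using that by (subst adj_weighted(1)) auto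
  then have adj_in: "std_adj k X \<in> ops ?K ?K" if "X \<in> ops ?K ?K" for X
    using that by (simp add: mat_op_in_ops)
  show "fd_vn_algebra k (ops ?K ?K)"
    using assms adj_in by (auto simp: fd_vn_algebra_def subspace_ops id_op_in_ops ops_comp)
  have tr: "op_trace ?K (X \<circ> Y) = (\<Sum>p<k. \<Sum>r<k. X (ket r) p * Y (ket p) r)"
    if "X \<in> ops ?K ?K" "Y \<in> ops ?K ?K" for X Y
    unfolding op_trace_def by (intro sum.cong refl comp_ket[OF _ that(2,1)]) auto
  have comm: "op_trace ?K (X \<circ> Y) = op_trace ?K (Y \<circ> X)" if "X \<in> ops ?K ?K" "Y \<in> ops ?K ?K" for X Y
    unfolding tr[OF that] tr[OF that(2,1)] by (subst sum.swap) (simp add: mult.commute)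
  have sq: "op_trace ?K (std_adj k X \<circ> X) = of_real (\<Sum>p<k. \<Sum>r<k. (cmod (X (ket p) r))\<^sup>2)"
    if X: "X \<in> ops ?K ?K" for X
    unfolding tr[OF adj_in[OF X] X] by (simp add: adj[OF X] complex_norm_square[symmetric] mult.commute)
  have zero: "X = 0" if X: "X \<in> ops ?K ?K" and 0: "(\<Sum>p<k. \<Sum>r<k. (cmod (X (ket p) r))\<^sup>2) = 0" for X
  proof (rule ops_eqI[OF _ X])
    fix p q assume "p \<in> ?K" "q \<in> ?K"
    then show "X (ket q) p = 0 (ket q) p"
      using 0 by (simp add: sum_nonneg_eq_0_iff sum_nonneg)
  qed (auto intro: cop.subspace_0[OF subspace_ops])
  show "faithful_trace k (ops ?K ?K) (op_trace ?K)"
    unfolding faithful_trace_def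
  proof (intro conjI ballI allI impI)
    fix X assume X: "X \<in> ops ?K ?K"
    show "op_trace ?K (std_adj k X \<circ> X) \<in> \<real>" by (simp only: sq[OF X] Reals_of_real)
    show "0 \<le> Re (op_trace ?K (std_adj k X \<circ> X))"
      by (simp only: sq[OF X] Re_complex_of_real) (simp add: sum_nonneg)
    show "X = 0" if "op_trace ?K (std_adj k X \<circ> X) = 0"
      using that by (intro zero[OF X]) (simp only: sq[OF X] of_real_eq_0_iff)
    show "op_trace ?K (X \<circ> Y) = op_trace ?K (Y \<circ> X)" if "Y \<in> ops ?K ?K" for Y
      by (rule comm[OF X that])
  qed (simp_all add: op_trace_def sum.distrib oscale_def cscale_def sum_distrib_left)
qed

lemma complete_graph_colorable:
  assumes blocks: "\<forall>n\<in>set ns. 1 \<le> n"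
    and S: "S = {X \<in> bl2 ns. \<forall>p\<in>midx ns. slice_trace ns p X = 0}"
  shows "quantum_colorable ns S (mdim ns)"
proof -
  \<comment> \<open>Any positive common multiple of the block sizes works.\<close>
  define k where "k = prod_list ns"
  have "0 < k" using blocks unfolding k_def by (induction ns) auto
  have dvd: "ns ! i dvd k" if "(i, s, t) \<in> midx ns" for i s t
    using that unfolding k_def midx_iff by (intro prod_list_dvd) auto
  obtain h where h: "bij_betw h {1..mdim ns} (midx ns)"
    using ex_bij_betw_nat_finite_1[OF finite_midx] unfolding mdim_eq_card by blast
  define P where "P = (\<lambda>a. weyl_projection ns k (h a))"
  have "(\<Sum>a\<in>{1..mdim ns}. P a) = id_op (midx ns \<times> {..<k})"
    unfolding P_def sum.reindex_bij_betw[OF h] by (rule sum_weyl_projection)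
  moreover have "P a \<in> tensor_alg ns k (ops {..<k} {..<k}) \<and> P a \<circ> P a = P a \<and> tensor_adj ns k (P a) = P a"
    and "\<forall>X\<in>S. P a \<circ> ten_op (midx ns) {..<k} X (id_op {..<k}) \<circ> P a = 0"
    if "a \<in> {1..mdim ns}" for a
  proof -
    obtain i s t where hist: "h a = (i, s, t)" by (metis prod.exhaust)
    have mem: "(i, s, t) \<in> midx ns" using h that hist by (metis bij_betwE)
    show "P a \<in> tensor_alg ns k (ops {..<k} {..<k}) \<and> P a \<circ> P a = P a \<and> tensor_adj ns k (P a) = P a"
      unfolding P_def hist
      using weyl_projection_in_tensor_alg[OF mem] weyl_projection_idem[OF mem dvd[OF mem]]
        weyl_projection_adj by blast
    show "\<forall>X\<in>S. P a \<circ> ten_op (midx ns) {..<k} X (id_op {..<k}) \<circ> P a = 0"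
      unfolding P_def hist S using weyl_projection_compression[OF mem dvd[OF mem]] by blast
  qed
  ultimately have "quantum_coloring ns S (mdim ns) k (ops {..<k} {..<k}) P"
    unfolding quantum_coloring_def by blast
  then show ?thesis
    unfolding quantum_colorable_def using full_matrix_algebra[OF \<open>0 < k\<close>] by blast
qed


section \<open>Tightness of the bounds\<close>

theorem mainTheorem2:
  fixes ns :: "nat list"
    and A :: "(midx, midx) op"
    and S :: "(midx, midx) op set"
  assumes blocks: "\<forall>n\<in>set ns. 1 \<le> n"
    and dim_ge_2: "2 \<le> mdim ns"
    and graph: "quantum_graph ns A S"
    and irreflexive: "irreflexive_space ns S"
    and complete: "A = complete_adjacency ns"
  shows "let d = real (mdim ns);
             lmax = eig_max ns A; lmin = eig_min ns A;
             dimS = real (cop.dim S);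
             sp = sq_pos ns A; sm = sq_neg ns A;
             np = real (num_pos ns A); nm = real (num_neg ns A);
             gmax = eig_max ns (signless_laplacian ns A);
             gmin = eig_min ns (signless_laplacian ns A);
             tmax = eig_max ns (laplacian ns A)
         in 1 + lmax / \<bar>lmin\<bar> = 1 + dimS / (dimS - d * gmin)
          \<and> 1 + dimS / (dimS - d * gmin) = 1 + max (sp / sm) (sm / sp)
          \<and> 1 + max (sp / sm) (sm / sp) = 1 + max (np / nm) (nm / np)
          \<and> 1 + max (np / nm) (nm / np) = 1 + lmax / (lmax - gmax + tmax)
          \<and> 1 + lmax / (lmax - gmax + tmax) = d
          \<and> chi_q ns S = enat (mdim ns)"
proof -
  define d where "d = real (mdim ns)"
  have d: "2 \<le> d" using dim_ge_2 by (simp add: d_def)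
  have pos: "0 < mdim ns" using dim_ge_2 by simp
  have S: "S = {X \<in> bl2 ns. \<forall>p\<in>midx ns. slice_trace ns p X = 0}"
    using complete_graph_space graph irreflexive complete by blast
  have dimS: "real (cop.dim S) = d * d - d"
    unfolding S dim_complete_graph_space d_def by (simp add: of_nat_diff)
  note specA = spectrum_rank_one_perturbation[OF complete_adjacency_apply _ dim_ge_2,
      folded complete d_def]
  have eA: "eigvals ns A = {- 1, d - 1}"
    and m1: "eig_mult ns A (- 1) = mdim ns - 1" and m2: "eig_mult ns A (d - 1) = 1"
    using specA d by (auto simp: add.commute)
  have signless: "signless_laplacian ns A x =
      cscale (of_real (d - 2)) x + cscale (of_real d * psi ns x) (mone ns)" if "x \<in> malg ns" for x
    unfolding signless_laplacian_def complete plus_fun_apply d_def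
      complete_degree_apply[OF that pos] complete_adjacency_apply[OF that]
    by (simp add: fun_eq_iff cscale_def algebra_simps)
  have lap: "laplacian ns A x =
      cscale (of_real d) x + cscale (of_real (- d) * psi ns x) (mone ns)" if "x \<in> malg ns" for x
    unfolding laplacian_def complete minus_apply d_def
      complete_degree_apply[OF that pos] complete_adjacency_apply[OF that]
    by (simp add: fun_eq_iff cscale_def algebra_simps)
  have eQ: "eigvals ns (signless_laplacian ns A) = {d - 2, d - 2 + d}"
    using spectrum_rank_one_perturbation(1)[OF signless _ dim_ge_2] d by simp
  have eL: "eigvals ns (laplacian ns A) = {d, 0}"
    using spectrum_rank_one_perturbation(1)[OF lap _ dim_ge_2] d by simp
  have lmax: "eig_max ns A = d - 1" and lmin: "eig_min ns A = - 1"
    using d by (simp_all add: eig_max_def eig_min_def eA)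
  have gmax: "eig_max ns (signless_laplacian ns A) = 2 * d - 2"
    and gmin: "eig_min ns (signless_laplacian ns A) = d - 2"
    using d by (simp_all add: eig_max_def eig_min_def eQ)
  have tmax: "eig_max ns (laplacian ns A) = d"
    using d by (simp add: eig_max_def eL)
  have dm: "real (mdim ns - 1) = d - 1" using pos by (simp add: d_def of_nat_diff)
  have "{r \<in> eigvals ns A. r > 0} = {d - 1}" "{r \<in> eigvals ns A. r < 0} = {- 1}"
    using d by (auto simp: eA)
  then have sp: "sq_pos ns A = (d - 1)\<^sup>2" and sm: "sq_neg ns A = d - 1"
    and np: "real (num_pos ns A) = 1" and nm: "real (num_neg ns A) = d - 1"
    using dm by (simp_all add: sq_pos_def sq_neg_def num_pos_def num_neg_def m1 m2)
  have le: "1 / (d - 1) \<le> d - 1"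
    by (rule order_trans[of _ 1]) (use d in simp_all)
  have "(d - 1)\<^sup>2 / (d - 1) = d - 1" "(d - 1) / (d - 1)\<^sup>2 = 1 / (d - 1)"
    using d by (simp_all add: power2_eq_square)
  then have ratio1: "max ((d - 1)\<^sup>2 / (d - 1)) ((d - 1) / (d - 1)\<^sup>2) = d - 1"
    using max_absorb1[OF le] by simp
  have ratio2: "max (1 / (d - 1)) ((d - 1) / 1) = d - 1"
    using max_absorb2[OF le] by simp
  have ratio3: "(d * d - d) / (d * d - d - d * (d - 2)) = d - 1"
    using d by (simp add: field_simps)
  have "complete_adjacency ns \<in> S"
    using S complete_adjacency_in_bl2 slice_trace_complete_adjacency by blast
  then have lower: "mdim ns \<le> c" if "quantum_colorable ns S c" for c
    using that coloring_lower_bound[OF _ _ _ pos] unfolding quantum_colorable_def by blast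
  have "chi_q ns S = enat (mdim ns)"
    unfolding chi_q_def
  proof (rule antisym)
    show "Inf {enat c |c. quantum_colorable ns S c} \<le> enat (mdim ns)"
      using complete_graph_colorable[OF blocks S] by (intro Inf_lower) blast
    show "enat (mdim ns) \<le> Inf {enat c |c. quantum_colorable ns S c}"
      using lower by (intro Inf_greatest) auto
  qed
  then show ?thesis
    unfolding Let_def lmax lmin gmax gmin tmax sp sm np nm dimS d_def[symmetric]
      ratio1 ratio2 ratio3 using d by simp
qed

end
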